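(* Let $H$ be a finite dimensional Hopf algebra over a field $k$ which is non-singular as a coalgebra. Then $H$ is cosemisimple.
   Context: A $k$-coalgebra $C$ is called non-singular if the dual algebra $C^*=\mathrm{Hom}_k(C,k)$ (convolution product) is a left non-singular ring, i.e. no non-zero element of $C^*$ has a left annihilator that is an essential left ideal. A coalgebra is cosemisimple if it equals its coradical, i.e. it is the sum of its simple subcoalgebras. *)

theory Defs
  imports Complex_Main "HOL-Library.Poly_Mapping" "HOL-Algebra.Ideal"
begin

section \<open>Free vector spaces\<close>

text \<open>
  The finitely supported functions \<open>'x \<Rightarrow>\<^sub>0 'k\<close> form the free vector space on the type \<open>'x\<close>,
  with basis the elements \<open>free_of x\<close>.  A function \<open>f\<close> into any vector space extends linearly
  to \<open>free_extend s f\<close>.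
\<close>

definition free_of :: "'x \<Rightarrow> 'x \<Rightarrow>\<^sub>0 'k::field"
  where "free_of x = Poly_Mapping.single x 1"

definition free_scale :: "'k::field \<Rightarrow> ('x \<Rightarrow>\<^sub>0 'k) \<Rightarrow> ('x \<Rightarrow>\<^sub>0 'k)"
  where "free_scale c p = Poly_Mapping.map ((*) c) p"

definition free_extend ::
    "('k::field \<Rightarrow> 'v::ab_group_add \<Rightarrow> 'v) \<Rightarrow> ('x \<Rightarrow> 'v) \<Rightarrow> ('x \<Rightarrow>\<^sub>0 'k) \<Rightarrow> 'v"
  where "free_extend s f p = (\<Sum>x\<in>Poly_Mapping.keys p. s (Poly_Mapping.lookup p x) (f x))"

lemma lookup_free_scale [simp]:
  "Poly_Mapping.lookup (free_scale c p) x = c * Poly_Mapping.lookup p x"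
  by (simp add: free_scale_def Poly_Mapping.map.rep_eq when_def)

lemma vector_space_free_scale: "vector_space free_scale"
  by unfold_locales
    (auto intro!: poly_mapping_eqI simp: lookup_add algebra_simps)

lemma vector_space_field: "vector_space ((*) :: 'k::field \<Rightarrow> 'k \<Rightarrow> 'k)"
  by unfold_locales (auto simp: algebra_simps)

lemma free_extend_superset:
  fixes s :: "'k::field \<Rightarrow> 'v::ab_group_add \<Rightarrow> 'v" and p :: "'x \<Rightarrow>\<^sub>0 'k"
  assumes "vector_space s" "finite A" "Poly_Mapping.keys p \<subseteq> A"
  shows "free_extend s f p = (\<Sum>x\<in>A. s (Poly_Mapping.lookup p x) (f x))"
proof -
  interpret vector_space s by fact
  show ?thesis unfolding free_extend_def
    by (rule sum.mono_neutral_left) (use assms in \<open>auto simp: in_keys_iff\<close>)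
qed

lemma free_extend_of [simp]:
  assumes "vector_space s"
  shows "free_extend s f (free_of x) = f x"
proof -
  interpret vector_space s by fact
  show ?thesis by (simp add: free_extend_def free_of_def)
qed

lemma linear_free_extend:
  fixes s :: "'k::field \<Rightarrow> 'v::ab_group_add \<Rightarrow> 'v" and f :: "'x \<Rightarrow> 'v"
  assumes "vector_space s"
  shows "Vector_Spaces.linear free_scale s (free_extend s f)"
proof -
  interpret s: vector_space s by fact
  show ?thesis
  unfolding Vector_Spaces.linear_iff
  proof (intro conjI allI vector_space_free_scale assms)
    fix p q :: "'x \<Rightarrow>\<^sub>0 'k"
    let ?A = "Poly_Mapping.keys p \<union> Poly_Mapping.keys q"
    show "free_extend s f (p + q) = free_extend s f p + free_extend s f q"
      using Poly_Mapping.keys_add[of p q]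
      by (simp add: free_extend_superset[OF assms, of ?A] lookup_add s.scale_left_distrib
          sum.distrib)
  next
    fix c and p :: "'x \<Rightarrow>\<^sub>0 'k"
    have "Poly_Mapping.keys (free_scale c p) \<subseteq> Poly_Mapping.keys p"
      by (auto simp: in_keys_iff)
    then show "free_extend s f (free_scale c p) = s c (free_extend s f p)"
      by (simp add: free_extend_superset[OF assms, of "Poly_Mapping.keys p"] s.scale_sum_right)
  qed
qed


section \<open>Tensor squares and cubes\<close>

text \<open>
  For a vector space \<open>V\<close> over \<open>k\<close> with scalar multiplication \<open>s\<close>, the spaces \<open>V \<otimes> V\<close> and
  \<open>V \<otimes> V \<otimes> V\<close> are the quotients of the free vector spaces on \<open>V \<times> V\<close> and \<open>V \<times> V \<times> V\<close> by the
  spans \<open>tensor2_null s\<close> and \<open>tensor3_null s\<close> of the bilinearity and trilinearity relations.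
  The elements of these quotients are cosets, that is, sets of formal sums.
\<close>

definition tensor2_null ::
    "('k::field \<Rightarrow> 'v::ab_group_add \<Rightarrow> 'v) \<Rightarrow> ('v \<times> 'v \<Rightarrow>\<^sub>0 'k) set"
  where "tensor2_null s = module.span free_scale
    ({free_of (a + a', b) - free_of (a, b) - free_of (a', b) | a a' b. True} \<union>
     {free_of (a, b + b') - free_of (a, b) - free_of (a, b') | a b b'. True} \<union>
     {free_of (s r a, b) - free_scale r (free_of (a, b)) | r a b. True} \<union>
     {free_of (a, s r b) - free_scale r (free_of (a, b)) | r a b. True})"

definition tensor3_null ::
    "('k::field \<Rightarrow> 'v::ab_group_add \<Rightarrow> 'v) \<Rightarrow> ('v \<times> 'v \<times> 'v \<Rightarrow>\<^sub>0 'k) set"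
  where "tensor3_null s = module.span free_scale
    ({free_of (a + a', b, c) - free_of (a, b, c) - free_of (a', b, c) | a a' b c. True} \<union>
     {free_of (a, b + b', c) - free_of (a, b, c) - free_of (a, b', c) | a b b' c. True} \<union>
     {free_of (a, b, c + c') - free_of (a, b, c) - free_of (a, b, c') | a b c c'. True} \<union>
     {free_of (s r a, b, c) - free_scale r (free_of (a, b, c)) | r a b c. True} \<union>
     {free_of (a, s r b, c) - free_scale r (free_of (a, b, c)) | r a b c. True} \<union>
     {free_of (a, b, s r c) - free_scale r (free_of (a, b, c)) | r a b c. True})"

definition tensor2_class ::
    "('k::field \<Rightarrow> 'v::ab_group_add \<Rightarrow> 'v) \<Rightarrow> ('v \<times> 'v \<Rightarrow>\<^sub>0 'k) \<Rightarrow> ('v \<times> 'v \<Rightarrow>\<^sub>0 'k) set"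
  where "tensor2_class s p = {q. q - p \<in> tensor2_null s}"

definition tensor3_class ::
    "('k::field \<Rightarrow> 'v::ab_group_add \<Rightarrow> 'v) \<Rightarrow>
      ('v \<times> 'v \<times> 'v \<Rightarrow>\<^sub>0 'k) \<Rightarrow> ('v \<times> 'v \<times> 'v \<Rightarrow>\<^sub>0 'k) set"
  where "tensor3_class s p = {q. q - p \<in> tensor3_null s}"

definition tensor2_space ::
    "('k::field \<Rightarrow> 'v::ab_group_add \<Rightarrow> 'v) \<Rightarrow> ('v \<times> 'v \<Rightarrow>\<^sub>0 'k) set set"
  where "tensor2_space s = range (tensor2_class s)"

text \<open>
  Maps out of a quotient are computed on a representative of the coset.  All the functions to
  which this is applied below are independent of the representative: see
  \<open>bilinear_extend_class\<close> for maps with values in a vector space.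
\<close>

definition tensor_rep :: "('x \<Rightarrow>\<^sub>0 'k::field) set \<Rightarrow> ('x \<Rightarrow>\<^sub>0 'k)"
  where "tensor_rep X = (SOME p. p \<in> X)"

definition tensor2_add ::
    "('k::field \<Rightarrow> 'v::ab_group_add \<Rightarrow> 'v) \<Rightarrow>
      ('v \<times> 'v \<Rightarrow>\<^sub>0 'k) set \<Rightarrow> ('v \<times> 'v \<Rightarrow>\<^sub>0 'k) set \<Rightarrow> ('v \<times> 'v \<Rightarrow>\<^sub>0 'k) set"
  where "tensor2_add s X Y = tensor2_class s (tensor_rep X + tensor_rep Y)"

definition tensor2_scale ::
    "('k::field \<Rightarrow> 'v::ab_group_add \<Rightarrow> 'v) \<Rightarrow>
      'k \<Rightarrow> ('v \<times> 'v \<Rightarrow>\<^sub>0 'k) set \<Rightarrow> ('v \<times> 'v \<Rightarrow>\<^sub>0 'k) set"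
  where "tensor2_scale s r X = tensor2_class s (free_scale r (tensor_rep X))"

text \<open>
  \<open>tensor2_lift s \<beta>\<close> is the linear map on \<open>V \<otimes> V\<close> sending \<open>a \<otimes> b\<close> to \<open>\<beta> a b\<close>, for a bilinear map
  \<open>\<beta>\<close> into a space with scalar multiplication \<open>s\<close>.
\<close>

definition tensor2_lift ::
    "('k::field \<Rightarrow> 'w::ab_group_add \<Rightarrow> 'w) \<Rightarrow> ('v \<Rightarrow> 'v \<Rightarrow> 'w) \<Rightarrow> ('v \<times> 'v \<Rightarrow>\<^sub>0 'k) set \<Rightarrow> 'w"
  where "tensor2_lift s \<beta> X = free_extend s (\<lambda>(a, b). \<beta> a b) (tensor_rep X)"

lemma tensor2_class_eq_iff:
  fixes s :: "'k::field \<Rightarrow> 'v::ab_group_add \<Rightarrow> 'v"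
  shows "tensor2_class s p = tensor2_class s q \<longleftrightarrow> p - q \<in> tensor2_null s"
proof -
  interpret vector_space "free_scale :: 'k \<Rightarrow> ('v \<times> 'v \<Rightarrow>\<^sub>0 'k) \<Rightarrow> _"
    by (rule vector_space_free_scale)
  have sub: "subspace (tensor2_null s)"
    unfolding tensor2_null_def by (rule subspace_span)
  show ?thesis
  proof
    assume "tensor2_class s p = tensor2_class s q"
    moreover have "p \<in> tensor2_class s p"
      using subspace_0[OF sub] by (simp add: tensor2_class_def)
    ultimately show "p - q \<in> tensor2_null s"
      by (auto simp: tensor2_class_def)
  next
    assume *: "p - q \<in> tensor2_null s"
    have "x - p \<in> tensor2_null s \<longleftrightarrow> x - q \<in> tensor2_null s" for x
      using subspace_add[OF sub _ *, of "x - p"] subspace_diff[OF sub _ *, of "x - q"] by auto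
    then show "tensor2_class s p = tensor2_class s q"
      by (simp add: tensor2_class_def)
  qed
qed

lemma tensor2_class_rep:
  fixes s :: "'k::field \<Rightarrow> 'v::ab_group_add \<Rightarrow> 'v"
  assumes "X \<in> tensor2_space s"
  shows "tensor2_class s (tensor_rep X) = X"
proof -
  interpret vector_space "free_scale :: 'k \<Rightarrow> ('v \<times> 'v \<Rightarrow>\<^sub>0 'k) \<Rightarrow> _"
    by (rule vector_space_free_scale)
  obtain p where p: "X = tensor2_class s p"
    using assms by (auto simp: tensor2_space_def)
  have "p \<in> X"
    using span_zero by (simp add: p tensor2_class_def tensor2_null_def)
  then have "tensor_rep X \<in> X"
    unfolding tensor_rep_def by (rule someI)
  then show ?thesis
    unfolding p tensor2_class_eq_iff by (simp add: tensor2_class_def)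
qed

lemma bilinear_extend_class:
  fixes s :: "'k::field \<Rightarrow> 'v::ab_group_add \<Rightarrow> 'v"
    and t :: "'k \<Rightarrow> 'w::ab_group_add \<Rightarrow> 'w"
  assumes t: "vector_space t"
    and \<beta>1: "\<And>b. Vector_Spaces.linear s t (\<lambda>a. \<beta> a b)"
    and \<beta>2: "\<And>a. Vector_Spaces.linear s t (\<beta> a)"
    and pq: "tensor2_class s p = tensor2_class s q"
  shows "free_extend t (\<lambda>(a, b). \<beta> a b) p = free_extend t (\<lambda>(a, b). \<beta> a b) q"
proof -
  let ?F = "free_extend t (\<lambda>(a, b). \<beta> a b)"
  interpret f: vector_space "free_scale :: 'k \<Rightarrow> ('v \<times> 'v \<Rightarrow>\<^sub>0 'k) \<Rightarrow> _"
    by (rule vector_space_free_scale)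
  interpret t: vector_space t by fact
  interpret F: Vector_Spaces.linear free_scale t ?F
    by (rule linear_free_extend[OF t])
  note lin1 = Vector_Spaces.linear.axioms(3)[OF \<beta>1, THEN module_hom.add]
    Vector_Spaces.linear.axioms(3)[OF \<beta>1, THEN module_hom.scale]
  note lin2 = Vector_Spaces.linear.axioms(3)[OF \<beta>2, THEN module_hom.add]
    Vector_Spaces.linear.axioms(3)[OF \<beta>2, THEN module_hom.scale]
  have "?F x = 0" if "x \<in> tensor2_null s" for x
    using that unfolding tensor2_null_def
  proof (induction rule: f.span_induct)
    case base
    show ?case by (auto simp: f.subspace_def F.add F.scale F.zero)
  next
    case (step x)
    then show ?case
      by (auto simp: F.diff F.scale t lin1 lin2)
  qed
  from this[of "p - q"] show ?thesis
    using pq by (simp add: tensor2_class_eq_iff F.diff)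
qed


section \<open>Coalgebras\<close>

text \<open>
  For \<open>\<Delta> : C \<rightarrow> C \<otimes> C\<close>, the maps \<open>comult_left s \<Delta>\<close> and \<open>comult_right s \<Delta>\<close> from \<open>C \<otimes> C\<close> to
  \<open>C \<otimes> C \<otimes> C\<close> are \<open>\<Delta> \<otimes> id\<close> and \<open>id \<otimes> \<Delta>\<close>.
\<close>

definition comult_left ::
    "('k::field \<Rightarrow> 'c::ab_group_add \<Rightarrow> 'c) \<Rightarrow> ('c \<Rightarrow> ('c \<times> 'c \<Rightarrow>\<^sub>0 'k) set) \<Rightarrow>
      ('c \<times> 'c \<Rightarrow>\<^sub>0 'k) set \<Rightarrow> ('c \<times> 'c \<times> 'c \<Rightarrow>\<^sub>0 'k) set"
  where "comult_left s \<Delta> X = tensor3_class s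
    (free_extend free_scale
      (\<lambda>(a, b). free_extend free_scale (\<lambda>(a1, a2). free_of (a1, a2, b)) (tensor_rep (\<Delta> a)))
      (tensor_rep X))"

definition comult_right ::
    "('k::field \<Rightarrow> 'c::ab_group_add \<Rightarrow> 'c) \<Rightarrow> ('c \<Rightarrow> ('c \<times> 'c \<Rightarrow>\<^sub>0 'k) set) \<Rightarrow>
      ('c \<times> 'c \<Rightarrow>\<^sub>0 'k) set \<Rightarrow> ('c \<times> 'c \<times> 'c \<Rightarrow>\<^sub>0 'k) set"
  where "comult_right s \<Delta> X = tensor3_class s
    (free_extend free_scale
      (\<lambda>(a, b). free_extend free_scale (\<lambda>(b1, b2). free_of (a, b1, b2)) (tensor_rep (\<Delta> b)))
      (tensor_rep X))"

locale coalgebra = vector_space scale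
  for scale :: "'k::field \<Rightarrow> 'c::ab_group_add \<Rightarrow> 'c" +
  fixes \<Delta> :: "'c \<Rightarrow> ('c \<times> 'c \<Rightarrow>\<^sub>0 'k) set"
    and \<epsilon> :: "'c \<Rightarrow> 'k"
  assumes comult_closed: "\<Delta> c \<in> tensor2_space scale"
    and comult_add: "\<Delta> (c + d) = tensor2_add scale (\<Delta> c) (\<Delta> d)"
    and comult_scale: "\<Delta> (scale r c) = tensor2_scale scale r (\<Delta> c)"
    and counit_linear: "Vector_Spaces.linear scale (*) \<epsilon>"
    and coassociative: "comult_left scale \<Delta> (\<Delta> c) = comult_right scale \<Delta> (\<Delta> c)"
    and counit_left: "tensor2_lift scale (\<lambda>a b. scale (\<epsilon> a) b) (\<Delta> c) = c"
    and counit_right: "tensor2_lift scale (\<lambda>a b. scale (\<epsilon> b) a) (\<Delta> c) = c"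

text \<open>
  \<open>D\<close> is a subcoalgebra iff it is a subspace with \<open>\<Delta> D \<subseteq> D \<otimes> D\<close>, where \<open>D \<otimes> D\<close> is identified with
  its image in \<open>C \<otimes> C\<close>, the set of classes of formal sums supported on \<open>D \<times> D\<close>.
\<close>

definition subcoalgebra ::
    "('k::field \<Rightarrow> 'c::ab_group_add \<Rightarrow> 'c) \<Rightarrow> ('c \<Rightarrow> ('c \<times> 'c \<Rightarrow>\<^sub>0 'k) set) \<Rightarrow> 'c set \<Rightarrow> bool"
  where "subcoalgebra s \<Delta> D \<longleftrightarrow> module.subspace s D \<and>
    (\<forall>d\<in>D. \<Delta> d \<in> tensor2_class s ` {p. Poly_Mapping.keys p \<subseteq> D \<times> D})"

definition simple_subcoalgebra ::
    "('k::field \<Rightarrow> 'c::ab_group_add \<Rightarrow> 'c) \<Rightarrow> ('c \<Rightarrow> ('c \<times> 'c \<Rightarrow>\<^sub>0 'k) set) \<Rightarrow> 'c set \<Rightarrow> bool"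
  where "simple_subcoalgebra s \<Delta> D \<longleftrightarrow> subcoalgebra s \<Delta> D \<and> D \<noteq> {0} \<and>
    (\<forall>E. subcoalgebra s \<Delta> E \<longrightarrow> E \<subseteq> D \<longrightarrow> E = {0} \<or> E = D)"

definition coradical ::
    "('k::field \<Rightarrow> 'c::ab_group_add \<Rightarrow> 'c) \<Rightarrow> ('c \<Rightarrow> ('c \<times> 'c \<Rightarrow>\<^sub>0 'k) set) \<Rightarrow> 'c set"
  where "coradical s \<Delta> = module.span s (\<Union>{D. simple_subcoalgebra s \<Delta> D})"

definition cosemisimple ::
    "('k::field \<Rightarrow> 'c::ab_group_add \<Rightarrow> 'c) \<Rightarrow> ('c \<Rightarrow> ('c \<times> 'c \<Rightarrow>\<^sub>0 'k) set) \<Rightarrow> bool"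
  where "cosemisimple s \<Delta> \<longleftrightarrow> coradical s \<Delta> = UNIV"


section \<open>Non-singular rings and non-singular coalgebras\<close>

definition left_ideal :: "('a, 'm) ring_scheme \<Rightarrow> 'a set \<Rightarrow> bool"
  where "left_ideal R I \<longleftrightarrow> additive_subgroup I R \<and>
    (\<forall>r\<in>carrier R. \<forall>x\<in>I. r \<otimes>\<^bsub>R\<^esub> x \<in> I)"

definition essential_left_ideal :: "('a, 'm) ring_scheme \<Rightarrow> 'a set \<Rightarrow> bool"
  where "essential_left_ideal R I \<longleftrightarrow> left_ideal R I \<and>
    (\<forall>J. left_ideal R J \<longrightarrow> J \<noteq> {\<zero>\<^bsub>R\<^esub>} \<longrightarrow> I \<inter> J \<noteq> {\<zero>\<^bsub>R\<^esub>})"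

definition left_annihilator :: "('a, 'm) ring_scheme \<Rightarrow> 'a \<Rightarrow> 'a set"
  where "left_annihilator R x = {r \<in> carrier R. r \<otimes>\<^bsub>R\<^esub> x = \<zero>\<^bsub>R\<^esub>}"

definition left_nonsingular_ring :: "('a, 'm) ring_scheme \<Rightarrow> bool"
  where "left_nonsingular_ring R \<longleftrightarrow>
    (\<forall>x\<in>carrier R. x \<noteq> \<zero>\<^bsub>R\<^esub> \<longrightarrow> \<not> essential_left_ideal R (left_annihilator R x))"

text \<open>The convolution product is \<open>(f * g)(c) = \<Sum> f(c\<^sub>1) g(c\<^sub>2)\<close>, for \<open>\<Delta> c = \<Sum> c\<^sub>1 \<otimes> c\<^sub>2\<close>.\<close>

definition dual_algebra ::
    "('k::field \<Rightarrow> 'c::ab_group_add \<Rightarrow> 'c) \<Rightarrow> ('c \<Rightarrow> ('c \<times> 'c \<Rightarrow>\<^sub>0 'k) set) \<Rightarrow> ('c \<Rightarrow> 'k) \<Rightarrow>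
      ('c \<Rightarrow> 'k) ring"
  where "dual_algebra s \<Delta> \<epsilon> =
    \<lparr>carrier = {f. Vector_Spaces.linear s (*) f},
     monoid.mult = (\<lambda>f g c. tensor2_lift (*) (\<lambda>a b. f a * g b) (\<Delta> c)),
     one = \<epsilon>,
     zero = (\<lambda>c. 0),
     add = (\<lambda>f g c. f c + g c)\<rparr>"

definition nonsingular_coalgebra ::
    "('k::field \<Rightarrow> 'c::ab_group_add \<Rightarrow> 'c) \<Rightarrow> ('c \<Rightarrow> ('c \<times> 'c \<Rightarrow>\<^sub>0 'k) set) \<Rightarrow> ('c \<Rightarrow> 'k) \<Rightarrow> bool"
  where "nonsingular_coalgebra s \<Delta> \<epsilon> \<longleftrightarrow> left_nonsingular_ring (dual_algebra s \<Delta> \<epsilon>)"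


section \<open>Hopf algebras\<close>

text \<open>
  The underlying associative unital ring of a Hopf algebra is given by the class \<open>ring_1\<close>.
  This class requires \<open>0 \<noteq> 1\<close>, which holds in every bialgebra over a field because the counit maps \<open>1\<close> to
  \<open>1\<close>.
\<close>

definition tensor2_mult ::
    "('k::field \<Rightarrow> 'h::ring_1 \<Rightarrow> 'h) \<Rightarrow>
      ('h \<times> 'h \<Rightarrow>\<^sub>0 'k) set \<Rightarrow> ('h \<times> 'h \<Rightarrow>\<^sub>0 'k) set \<Rightarrow> ('h \<times> 'h \<Rightarrow>\<^sub>0 'k) set"
  where "tensor2_mult s X Y = tensor2_class s
    (free_extend free_scale
      (\<lambda>(a, b). free_extend free_scale (\<lambda>(a', b'). free_of (a * a', b * b')) (tensor_rep Y))
      (tensor_rep X))"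

locale bialgebra = coalgebra scale \<Delta> \<epsilon>
  for scale :: "'k::field \<Rightarrow> 'h::ring_1 \<Rightarrow> 'h" and \<Delta> \<epsilon> +
  assumes scale_mult_left: "scale r (x * y) = scale r x * y"
    and scale_mult_right: "scale r (x * y) = x * scale r y"
    and comult_mult: "\<Delta> (x * y) = tensor2_mult scale (\<Delta> x) (\<Delta> y)"
    and comult_one: "\<Delta> 1 = tensor2_class scale (free_of (1, 1))"
    and counit_mult: "\<epsilon> (x * y) = \<epsilon> x * \<epsilon> y"
    and counit_one: "\<epsilon> 1 = 1"

locale hopf_algebra = bialgebra scale \<Delta> \<epsilon>
  for scale :: "'k::field \<Rightarrow> 'h::ring_1 \<Rightarrow> 'h" and \<Delta> \<epsilon> +
  fixes S :: "'h \<Rightarrow> 'h"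
  assumes antipode_linear: "Vector_Spaces.linear scale scale S"
    and antipode_left: "tensor2_lift scale (\<lambda>a b. S a * b) (\<Delta> x) = scale (\<epsilon> x) 1"
    and antipode_right: "tensor2_lift scale (\<lambda>a b. a * S b) (\<Delta> x) = scale (\<epsilon> x) 1"

end

theory Submission
  imports Defs
begin

text \<open>
  Write \<open>A = H\<^sup>*\<close>.  A non-zero left integral \<open>\<Lambda> \<in> A\<close> exists by a trace formula, and its left
  annihilator is the augmentation ideal \<open>{f. f 1 = 0}\<close>.  If \<open>A\<close> is left non-singular, this ideal
  is not essential; a non-zero element of a left ideal meeting it trivially is an integral \<open>j\<close> with
  \<open>j 1 \<noteq> 0\<close>, normalised to \<open>j 1 = 1\<close>.  Then \<open>\<tau> x y = j (x * S y)\<close> is a coseparability form: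
  \<open>\<Sum> \<tau> x\<^sub>1 x\<^sub>2 = \<epsilon> x\<close> and \<open>\<Sum> x\<^sub>1 \<tau> x\<^sub>2 y = \<Sum> \<tau> x y\<^sub>1 y\<^sub>2\<close>.  Averaging a linear projection onto a
  subcoalgebra with \<open>\<tau>\<close> yields a central idempotent of \<open>A\<close>, hence a complementary subcoalgebra, and
  induction on the dimension shows that every subcoalgebra is contained in the coradical.
\<close>

section \<open>Linear maps on free vector spaces and on the tensor cube\<close>

lemma linear_add: "Vector_Spaces.linear s t f \<Longrightarrow> f (x + y) = f x + f y"
  and linear_scale: "Vector_Spaces.linear s t f \<Longrightarrow> f (s c x) = t c (f x)"
  and linear_vector_space: "Vector_Spaces.linear s t f \<Longrightarrow> vector_space t"
  by (simp_all add: Vector_Spaces.linear_iff)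

lemma linear_sum: "Vector_Spaces.linear s t f \<Longrightarrow> f (sum g A) = (\<Sum>a\<in>A. f (g a))"
  by (rule module_hom.sum[OF Vector_Spaces.linear.axioms(3)])

lemma linear_diff: "Vector_Spaces.linear s t f \<Longrightarrow> f (x - y) = f x - f y"
  by (rule module_hom.diff[OF Vector_Spaces.linear.axioms(3)])

lemma linear_zero: "Vector_Spaces.linear s t f \<Longrightarrow> f 0 = 0"
  by (rule module_hom.zero[OF Vector_Spaces.linear.axioms(3)])

text \<open>Composing extensions turns the nested formal sums in \<open>comult_left\<close>,
  \<open>comult_right\<close> and \<open>tensor2_mult\<close> into iterated Sweedler sums.\<close>

lemma free_extend_free_extend:
  fixes t :: "'k::field \<Rightarrow> 'w::ab_group_add \<Rightarrow> 'w"
  assumes t: "vector_space t"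
  shows "free_extend t g (free_extend free_scale f p) = free_extend t (\<lambda>x. free_extend t g (f x)) p"
proof -
  have G: "Vector_Spaces.linear free_scale t (free_extend t g)" by (rule linear_free_extend[OF t])
  show ?thesis
    unfolding free_extend_def[of free_scale f p] free_extend_def[of t "\<lambda>x. free_extend t g (f x)" p]
    by (simp add: linear_sum[OF G] linear_scale[OF G])
qed

lemma free_extend_free_of: "free_extend free_scale free_of p = p"
proof (rule poly_mapping_eqI)
  fix x
  have "Poly_Mapping.lookup (free_extend free_scale free_of p) x =
    (\<Sum>y\<in>Poly_Mapping.keys p. Poly_Mapping.lookup p y * (if y = x then 1 else 0))"
    by (simp add: free_extend_def lookup_sum free_of_def lookup_single when_def)
  also have "\<dots> = Poly_Mapping.lookup p x"
    by (simp add: if_distrib[of "(*) _"] in_keys_iff cong: if_cong)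
  finally show "Poly_Mapping.lookup (free_extend free_scale free_of p) x = Poly_Mapping.lookup p x" .
qed

text \<open>A trilinear map kills every generator of \<open>tensor3_null\<close>. Through this fact
  coassociativity, an equality of cosets, becomes an equality of iterated sums in
  \<open>sw_coassoc\<close>.\<close>

lemma trilinear_extend_class:
  fixes s :: "'k::field \<Rightarrow> 'v::ab_group_add \<Rightarrow> 'v"
    and t :: "'k \<Rightarrow> 'w::ab_group_add \<Rightarrow> 'w"
  assumes t: "vector_space t"
    and \<gamma>1: "\<And>b c. Vector_Spaces.linear s t (\<lambda>a. \<gamma> a b c)"
    and \<gamma>2: "\<And>a c. Vector_Spaces.linear s t (\<lambda>b. \<gamma> a b c)"
    and \<gamma>3: "\<And>a b. Vector_Spaces.linear s t (\<lambda>c. \<gamma> a b c)"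
    and pq: "tensor3_class s p = tensor3_class s q"
  shows "free_extend t (\<lambda>(a, b, c). \<gamma> a b c) p = free_extend t (\<lambda>(a, b, c). \<gamma> a b c) q"
proof -
  let ?F = "free_extend t (\<lambda>(a, b, c). \<gamma> a b c)"
  interpret f: vector_space "free_scale :: 'k \<Rightarrow> ('v \<times> 'v \<times> 'v \<Rightarrow>\<^sub>0 'k) \<Rightarrow> _"
    by (rule vector_space_free_scale)
  interpret t: vector_space t by fact
  interpret F: Vector_Spaces.linear free_scale t ?F
    by (rule linear_free_extend[OF t])
  note lin = \<gamma>1[THEN linear_add] \<gamma>1[THEN linear_scale] \<gamma>2[THEN linear_add] \<gamma>2[THEN linear_scale]
    \<gamma>3[THEN linear_add] \<gamma>3[THEN linear_scale]
  have null: "?F x = 0" if "x \<in> tensor3_null s" for x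
    using that unfolding tensor3_null_def
  proof (induction rule: f.span_induct)
    case base
    show ?case by (auto simp: f.subspace_def F.add F.scale F.zero)
  next
    case (step x)
    then show ?case
      by (auto simp: F.diff F.scale t lin)
  qed
  have "p - p \<in> tensor3_null s"
    by (simp add: tensor3_null_def f.span_zero)
  then have "p \<in> tensor3_class s q"
    unfolding pq[symmetric] by (simp add: tensor3_class_def)
  then have "?F (p - q) = 0"
    by (intro null) (simp add: tensor3_class_def)
  then show ?thesis
    by (simp add: F.diff)
qed

section \<open>Sweedler sums\<close>

context coalgebra
begin

abbreviation lin :: "('k \<Rightarrow> 'w::ab_group_add \<Rightarrow> 'w) \<Rightarrow> ('c \<Rightarrow> 'w) \<Rightarrow> bool"
  where "lin t f \<equiv> Vector_Spaces.linear scale t f"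

text \<open>\<open>sw t \<beta> x\<close> is \<open>\<Sum> \<beta> x\<^sub>1 x\<^sub>2\<close>, with values in a space whose scalar multiplication is \<open>t\<close>.\<close>

definition sw :: "('k \<Rightarrow> 'w::ab_group_add \<Rightarrow> 'w) \<Rightarrow> ('c \<Rightarrow> 'c \<Rightarrow> 'w) \<Rightarrow> 'c \<Rightarrow> 'w"
  where "sw t \<beta> x = tensor2_lift t \<beta> (\<Delta> x)"

lemma sw_alt: "sw t \<beta> x = free_extend t (\<lambda>(a, b). \<beta> a b) (tensor_rep (\<Delta> x))"
  by (simp add: sw_def tensor2_lift_def)

lemma sw_sum_form:
  "sw t \<beta> x = (\<Sum>p\<in>Poly_Mapping.keys (tensor_rep (\<Delta> x)).
     t (Poly_Mapping.lookup (tensor_rep (\<Delta> x)) p) (\<beta> (fst p) (snd p)))"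
  by (simp add: sw_alt free_extend_def case_prod_beta)

text \<open>\<open>tensor_rep\<close> picks an unspecified element of the coset; for bilinear
  \<open>\<beta>\<close> any convenient representative of \<open>\<Delta> x\<close> may replace
  it.\<close>

lemma sw_class:
  assumes "\<And>b. lin t (\<lambda>a. \<beta> a b)" "\<And>a. lin t (\<beta> a)" "\<Delta> x = tensor2_class scale p"
  shows "sw t \<beta> x = free_extend t (\<lambda>(a, b). \<beta> a b) p"
  unfolding sw_alt
  by (rule bilinear_extend_class[OF linear_vector_space[OF assms(2)] assms(1,2)])
    (use assms(3) tensor2_class_rep[OF comult_closed, of x] in auto)

lemma linear_sw:
  assumes \<beta>: "\<And>b. lin t (\<lambda>a. \<beta> a b)" "\<And>a. lin t (\<beta> a)"
  shows "lin t (sw t \<beta>)"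
proof -
  note t = linear_vector_space[OF \<beta>(2)]
  note L = linear_free_extend[OF t]
  show ?thesis
    unfolding Vector_Spaces.linear_iff
  proof (intro conjI allI t vector_space_axioms)
    fix x y
    have "\<Delta> (x + y) = tensor2_class scale (tensor_rep (\<Delta> x) + tensor_rep (\<Delta> y))"
      by (simp add: comult_add tensor2_add_def)
    from sw_class[OF \<beta> this] show "sw t \<beta> (x + y) = sw t \<beta> x + sw t \<beta> y"
      by (simp add: linear_add[OF L] sw_alt)
  next
    fix c x
    have "\<Delta> (scale c x) = tensor2_class scale (free_scale c (tensor_rep (\<Delta> x)))"
      by (simp add: comult_scale tensor2_scale_def)
    from sw_class[OF \<beta> this] show "sw t \<beta> (scale c x) = t c (sw t \<beta> x)"
      by (simp add: linear_scale[OF L] sw_alt)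
  qed
qed

lemma linear_out_sw:
  assumes "Vector_Spaces.linear t u \<phi>"
  shows "\<phi> (sw t \<beta> x) = sw u (\<lambda>a b. \<phi> (\<beta> a b)) x"
  by (simp add: sw_sum_form linear_sum[OF assms] linear_scale[OF assms])

lemma sw_sum:
  assumes "vector_space t"
  shows "sw t (\<lambda>a b. \<Sum>j\<in>J. \<beta> j a b) x = (\<Sum>j\<in>J. sw t (\<beta> j) x)"
proof -
  interpret t: vector_space t by fact
  show ?thesis
    unfolding sw_sum_form t.scale_sum_right by (rule sum.swap)
qed

lemma sw_diff:
  assumes "vector_space t"
  shows "sw t (\<lambda>a b. \<beta> a b - \<gamma> a b) x = sw t \<beta> x - sw t \<gamma> x"
proof -
  interpret t: vector_space t by fact
  show ?thesis
    by (simp add: sw_sum_form t.scale_right_diff_distrib sum_subtractf)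
qed

lemma sw_scale:
  assumes "vector_space t"
  shows "sw t (\<lambda>a b. t c (\<beta> a b)) x = t c (sw t \<beta> x)"
proof -
  interpret t: vector_space t by fact
  show ?thesis
    by (simp add: sw_sum_form t.scale_sum_right mult.commute)
qed

lemma sw_swap:
  assumes "vector_space t"
  shows "sw t (\<lambda>a b. sw t (\<lambda>c d. \<gamma> a b c d) y) x = sw t (\<lambda>c d. sw t (\<lambda>a b. \<gamma> a b c d) x) y"
proof -
  interpret t: vector_space t by fact
  show ?thesis
    unfolding sw_sum_form t.scale_sum_right
    by (subst sum.swap) (simp add: mult.commute)
qed

lemma sw_coassoc:
  assumes \<gamma>: "\<And>b c. lin t (\<lambda>a. \<gamma> a b c)" "\<And>a c. lin t (\<lambda>b. \<gamma> a b c)" "\<And>a b. lin t (\<gamma> a b)"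
  shows "sw t (\<lambda>u c. sw t (\<lambda>a b. \<gamma> a b c) u) x = sw t (\<lambda>a u. sw t (\<lambda>b c. \<gamma> a b c) u) x"
proof -
  note t = linear_vector_space[OF \<gamma>(3)]
  from trilinear_extend_class[OF t \<gamma> coassociative[unfolded comult_left_def comult_right_def], of x]
  show ?thesis
    by (simp add: free_extend_free_extend[OF t] sw_alt case_prod_unfold t)
qed

lemma sw_counit_left:
  assumes "lin t \<phi>"
  shows "sw t (\<lambda>a b. t (\<epsilon> a) (\<phi> b)) x = \<phi> x"
  using linear_out_sw[OF assms, of "\<lambda>a b. scale (\<epsilon> a) b" x]
  by (simp add: linear_scale[OF assms] counit_left sw_def)

lemma sw_counit_right:
  assumes "lin t \<phi>"
  shows "sw t (\<lambda>a b. t (\<epsilon> b) (\<phi> a)) x = \<phi> x"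
  using linear_out_sw[OF assms, of "\<lambda>a b. scale (\<epsilon> b) a" x]
  by (simp add: linear_scale[OF assms] counit_right sw_def)

text \<open>Linearity side conditions are discharged by repeated resolution with this collection.
  Most rules allow an inner linear map \<open>g\<close> in place of the bare variable, so that they
  follow the syntax of nested Sweedler sums.\<close>

named_theorems lin_rules

lemma lin_id [lin_rules]: "lin scale (\<lambda>x. x)"
  by (simp add: Vector_Spaces.linear_iff vector_space_axioms)

lemma lin_scale_const [lin_rules]: "lin (*) g \<Longrightarrow> lin scale (\<lambda>x. scale (g x) c)"
  by (simp add: Vector_Spaces.linear_iff vector_space_axioms scale_left_distrib)

lemma lin_const_scale [lin_rules]: "lin scale g \<Longrightarrow> lin scale (\<lambda>x. scale c (g x))"
  by (simp add: Vector_Spaces.linear_iff scale_right_distrib mult.commute)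

lemma lin_mult_const_field [lin_rules]: "lin (*) g \<Longrightarrow> lin (*) (\<lambda>x. g x * c)"
  by (simp add: Vector_Spaces.linear_iff algebra_simps)

lemma lin_const_mult_field [lin_rules]: "lin (*) g \<Longrightarrow> lin (*) (\<lambda>x. c * g x)"
  by (simp add: Vector_Spaces.linear_iff algebra_simps)

lemma lin_comp: "Vector_Spaces.linear s t f \<Longrightarrow> lin s g \<Longrightarrow> lin t (\<lambda>x. f (g x))"
  by (simp add: Vector_Spaces.linear_iff)

lemmas lin_counit [lin_rules] = lin_comp[OF counit_linear]

lemma lin_sw_body [lin_rules]:
  assumes "\<And>a b. lin t (\<lambda>x. \<beta> x a b)"
  shows "lin t (\<lambda>x. sw t (\<beta> x) c)"
proof -
  interpret t: vector_space t by (rule linear_vector_space[OF assms])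
  show ?thesis
    using assms
    by (simp add: Vector_Spaces.linear_iff sw_sum_form t.scale_right_distrib sum.distrib
        t.scale_sum_right mult.commute)
qed

lemma lin_sw_arg [lin_rules]:
  assumes "\<And>b. lin t (\<lambda>a. \<beta> a b)" "\<And>a. lin t (\<beta> a)" "lin scale g"
  shows "lin t (\<lambda>x. sw t \<beta> (g x))"
  by (rule lin_comp[OF linear_sw[OF assms(1,2)] assms(3)])

lemma lin_add [lin_rules]: "lin t f \<Longrightarrow> lin t g \<Longrightarrow> lin t (\<lambda>x. f x + g x)"
  by (auto simp: Vector_Spaces.linear_iff vector_space.vector_space_assms(1))

lemma lin_diff [lin_rules]: "lin t f \<Longrightarrow> lin t g \<Longrightarrow> lin t (\<lambda>x. f x - g x)"
  by (auto simp: Vector_Spaces.linear_iff algebra_simps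
      module.scale_right_diff_distrib[OF module_iff_vector_space[THEN iffD2]])

lemma lin_sum [lin_rules]:
  assumes "vector_space t" "\<And>j. j \<in> J \<Longrightarrow> lin t (f j)"
  shows "lin t (\<lambda>x. \<Sum>j\<in>J. f j x)"
proof -
  interpret t: vector_space t by fact
  show ?thesis using assms
    by (simp add: Vector_Spaces.linear_iff t.scale_sum_right sum.distrib vector_space_axioms)
qed

end

context bialgebra
begin

lemma lin_mult_const [lin_rules]: "lin scale g \<Longrightarrow> lin scale (\<lambda>x. g x * c)"
  by (simp add: Vector_Spaces.linear_iff scale_mult_left distrib_right)

lemma lin_const_mult [lin_rules]: "lin scale g \<Longrightarrow> lin scale (\<lambda>x. c * g x)"
  by (simp add: Vector_Spaces.linear_iff scale_mult_right distrib_left)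

lemma sw_mult:
  assumes \<beta>: "\<And>b. lin t (\<lambda>a. \<beta> a b)" "\<And>a. lin t (\<beta> a)"
  shows "sw t \<beta> (x * y) = sw t (\<lambda>a b. sw t (\<lambda>c d. \<beta> (a * c) (b * d)) y) x"
proof -
  note t = linear_vector_space[OF \<beta>(2)]
  show ?thesis
    using sw_class[OF \<beta> comult_mult[unfolded tensor2_mult_def], of x y]
    by (simp add: free_extend_free_extend[OF t] sw_alt case_prod_unfold t)
qed

lemma sw_one:
  assumes \<beta>: "\<And>b. lin t (\<lambda>a. \<beta> a b)" "\<And>a. lin t (\<beta> a)"
  shows "sw t \<beta> 1 = \<beta> 1 1"
  using sw_class[OF \<beta> comult_one] linear_vector_space[OF \<beta>(2)] by simp

end

context hopf_algebra
begin

lemmas lin_antipode [lin_rules] = lin_comp[OF antipode_linear]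

lemma sw_antipode_left:
  assumes "lin t \<phi>"
  shows "sw t (\<lambda>a b. \<phi> (S a * b)) x = t (\<epsilon> x) (\<phi> 1)"
  using linear_out_sw[OF assms, of "\<lambda>a b. S a * b" x]
  by (simp add: linear_scale[OF assms] antipode_left[folded sw_def])

lemma sw_antipode_right:
  assumes "lin t \<phi>"
  shows "sw t (\<lambda>a b. \<phi> (a * S b)) x = t (\<epsilon> x) (\<phi> 1)"
  using linear_out_sw[OF assms, of "\<lambda>a b. a * S b" x]
  by (simp add: linear_scale[OF assms] antipode_right[folded sw_def])

end

section \<open>The antipode\<close>

context hopf_algebra
begin

text \<open>
  \<open>\<Delta>(S x)\<close> and \<open>\<Sum> S x\<^sub>2 \<otimes> S x\<^sub>1\<close> both arise by contracting
  \<open>\<Sum> \<Delta>(S x\<^sub>1) (x\<^sub>2 S x\<^sub>5 \<otimes> x\<^sub>3 S x\<^sub>4)\<close>: from the right with \<open>x\<^sub>3 S x\<^sub>4\<close>, or from the left with \<open>S x\<^sub>1 x\<^sub>2\<close>.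
\<close>

lemma sw_antipode:
  assumes \<beta>: "\<And>b. lin t (\<lambda>a. \<beta> a b)" "\<And>a. lin t (\<beta> a)"
  shows "sw t \<beta> (S x) = sw t (\<lambda>a b. \<beta> (S b) (S a)) x"
proof -
  note t = linear_vector_space[OF \<beta>(2)]
  note [lin_rules] = lin_comp[OF \<beta>(1)] lin_comp[OF \<beta>(2)]
  \<comment> \<open>With \<open>y\<close> split into four legs the arguments are
    \<open>p y\<^sub>1 S y\<^sub>4\<close> and \<open>q y\<^sub>2 S y\<^sub>3\<close>. The pair
    \<open>y\<^sub>2 S y\<^sub>3\<close> contracts first, which makes \<open>y\<^sub>1\<close> and
    the last leg adjacent.\<close>
  have C: "sw t (\<lambda>u v. sw t (\<lambda>a b. sw t (\<lambda>c d. \<beta> (p * (a * S d)) (q * (b * S c))) v) u) y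
      = t (\<epsilon> y) (\<beta> p q)" for p q y
  proof -
    have "sw t (\<lambda>b v. sw t (\<lambda>c d. \<beta> (p * (a * S d)) (q * (b * S c))) v) w
        = \<beta> (p * (a * S w)) q" for a w
    proof -
      have "sw t (\<lambda>b v. sw t (\<lambda>c d. \<beta> (p * (a * S d)) (q * (b * S c))) v) w
        = sw t (\<lambda>e d. sw t (\<lambda>b c. \<beta> (p * (a * S d)) (q * (b * S c))) e) w"
        by (rule sw_coassoc[symmetric]) (rule lin_rules)+
      also have "\<dots> = sw t (\<lambda>e d. t (\<epsilon> e) (\<beta> (p * (a * S d)) (q * 1))) w"
        by (subst sw_antipode_right) ((rule lin_rules)+, rule refl)
      also have "\<dots> = \<beta> (p * (a * S w)) (q * 1)"
        by (rule sw_counit_left) (rule lin_rules)+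
      finally show ?thesis by simp
    qed
    note inner = this
    have "sw t (\<lambda>u v. sw t (\<lambda>a b. sw t (\<lambda>c d. \<beta> (p * (a * S d)) (q * (b * S c))) v) u) y
      = sw t (\<lambda>a w. sw t (\<lambda>b v. sw t (\<lambda>c d. \<beta> (p * (a * S d)) (q * (b * S c))) v) w) y"
      by (rule sw_coassoc) (rule lin_rules)+
    also have "\<dots> = sw t (\<lambda>a w. \<beta> (p * (a * S w)) q) y"
      by (simp only: inner)
    also have "\<dots> = t (\<epsilon> y) (\<beta> (p * 1) q)"
      by (rule sw_antipode_right) (rule lin_rules)+
    finally show ?thesis by simp
  qed
  define Q where "Q r u v =
    sw t (\<lambda>p q. sw t (\<lambda>a b. sw t (\<lambda>c d. \<beta> (p * (a * S d)) (q * (b * S c))) v) u) (S r)" for r u v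
  \<comment> \<open>Multiplicativity merges the legs of \<open>S r\<close> and \<open>u\<close> into
    those of \<open>S r * u\<close>; summing over the legs \<open>r\<close>, \<open>u\<close> of
    \<open>y\<close> then applies the left antipode axiom.\<close>
  have Q: "sw t (\<lambda>r u. Q r u v) y = t (\<epsilon> y) (sw t (\<lambda>c d. \<beta> (S d) (S c)) v)" for y v
  proof -
    define \<Gamma> where "\<Gamma> m n = sw t (\<lambda>c d. \<beta> (m * S d) (n * S c)) v" for m n
    have \<Gamma>: "\<And>n. lin t (\<lambda>m. \<Gamma> m n)" "\<And>m. lin t (\<Gamma> m)"
      unfolding \<Gamma>_def by (rule lin_rules)+
    have "Q r u v = sw t \<Gamma> (S r * u)" for r u
      unfolding sw_mult[OF \<Gamma>] by (simp add: Q_def \<Gamma>_def mult.assoc)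
    then show ?thesis
      using sw_antipode_left[OF linear_sw[OF \<Gamma>], of y] sw_one[OF \<Gamma>] by (simp add: \<Gamma>_def)
  qed
  have "sw t \<beta> (S x) = sw t (\<lambda>r y. t (\<epsilon> y) (sw t \<beta> (S r))) x"
    by (rule sw_counit_right[symmetric]) (rule lin_rules \<beta>)+
  also have "\<dots> = sw t (\<lambda>r y. sw t (\<lambda>u v. Q r u v) y) x"
    unfolding Q_def by (subst sw_swap[OF t]) (simp only: C sw_scale[OF t])
  also have "\<dots> = sw t (\<lambda>y v. sw t (\<lambda>r u. Q r u v) y) x"
    unfolding Q_def by (rule sw_coassoc[symmetric]) (rule lin_rules)+
  also have "\<dots> = sw t (\<lambda>c d. \<beta> (S d) (S c)) x"
    unfolding Q by (rule sw_counit_left) (rule lin_rules)+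
  finally show ?thesis .
qed

text \<open>Apply \<open>\<epsilon>\<close> to the left antipode axiom; being multiplicative, it
  lets the counit axiom absorb the second leg.\<close>

lemma counit_antipode: "\<epsilon> (S x) = \<epsilon> x"
proof -
  have "sw (*) (\<lambda>a b. \<epsilon> (S a * b)) x = \<epsilon> x * \<epsilon> 1"
    by (rule sw_antipode_left) (rule counit_linear)
  moreover have "sw (*) (\<lambda>a b. \<epsilon> (S a * b)) x = sw (*) (\<lambda>a b. \<epsilon> b * \<epsilon> (S a)) x"
    by (simp add: counit_mult mult.commute)
  moreover have "\<dots> = \<epsilon> (S x)"
    by (rule sw_counit_right) (rule lin_rules)+
  ultimately show ?thesis by (simp add: counit_one)
qed

text \<open>The two reversals of the legs cancel, so \<open>S\<^sup>2\<close> is compatible with the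
  comultiplication.\<close>

lemma sw_antipode_twice:
  assumes \<beta>: "\<And>b. lin t (\<lambda>a. \<beta> a b)" "\<And>a. lin t (\<beta> a)"
  shows "sw t \<beta> (S (S x)) = sw t (\<lambda>a b. \<beta> (S (S a)) (S (S b))) x"
proof -
  note [lin_rules] = lin_comp[OF \<beta>(1)] lin_comp[OF \<beta>(2)]
  show ?thesis
    by (subst sw_antipode[OF \<beta>], subst sw_antipode) ((rule lin_rules)+, rule refl)
qed

text \<open>This is the antipode axiom at \<open>S x\<close>, whose legs are those of
  \<open>x\<close> in reverse order under \<open>S\<close>. The next lemma is its mirror
  image.\<close>

lemma sw_antipode_antipode_left:
  assumes \<phi>: "lin t \<phi>"
  shows "sw t (\<lambda>a b. \<phi> (S (S b) * S a)) x = t (\<epsilon> x) (\<phi> 1)"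
proof -
  note [lin_rules] = lin_comp[OF \<phi>]
  have "sw t (\<lambda>a b. \<phi> (S (S b) * S a)) x = sw t (\<lambda>a b. \<phi> (S a * b)) (S x)"
    by (rule sw_antipode[symmetric]) (rule lin_rules)+
  then show ?thesis by (simp add: sw_antipode_left[OF \<phi>] counit_antipode)
qed

lemma sw_antipode_antipode_right:
  assumes \<phi>: "lin t \<phi>"
  shows "sw t (\<lambda>a b. \<phi> (S b * S (S a))) x = t (\<epsilon> x) (\<phi> 1)"
proof -
  note [lin_rules] = lin_comp[OF \<phi>]
  have "sw t (\<lambda>a b. \<phi> (S b * S (S a))) x = sw t (\<lambda>a b. \<phi> (a * S b)) (S x)"
    by (rule sw_antipode[symmetric]) (rule lin_rules)+
  then show ?thesis by (simp add: sw_antipode_right[OF \<phi>] counit_antipode)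
qed

end

section \<open>Existence of a non-zero integral\<close>

locale fd_hopf_algebra =
  hopf_algebra scale \<Delta> \<epsilon> S + finite_dimensional_vector_space scale Basis
  for scale :: "'k::field \<Rightarrow> 'h::ring_1 \<Rightarrow> 'h" and \<Delta> \<epsilon> S Basis
begin

section \<open>Coordinates, traces and the action of the dual algebra\<close>

declare vector_space_axioms [lin_rules] vector_space_field [lin_rules]

text \<open>The basis vector comes first, so that the functionals \<open>cd b\<close> for
  \<open>b\<close> in \<open>Basis\<close> form the dual basis.\<close>

definition cd :: "'h \<Rightarrow> 'h \<Rightarrow> 'k"
  where "cd b v = representation Basis v b"

lemma lin_cd: "lin (*) (cd b)"
  using linear_representation[OF independent_Basis span_Basis, of b] by (simp add: cd_def[abs_def])

lemmas lin_cd_comp [lin_rules] = lin_comp[OF lin_cd]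

lemma sum_cd: "(\<Sum>b\<in>Basis. scale (cd b v) b) = v"
  unfolding cd_def
  by (rule sum_representation_eq) (simp_all add: independent_Basis span_Basis finite_Basis)

lemma linear_cd_expand: "lin t \<phi> \<Longrightarrow> (\<Sum>b\<in>Basis. t (cd b v) (\<phi> b)) = \<phi> v"
  using linear_sum[of scale t \<phi> "\<lambda>b. scale (cd b v) b" Basis]
  by (simp add: sum_cd linear_scale[of scale t \<phi>])

lemma eq_if_functionals_eq:
  assumes "\<And>f. lin (*) f \<Longrightarrow> f x = f y"
  shows "x = y"
proof -
  have "(\<Sum>b\<in>Basis. scale (cd b x) b) = (\<Sum>b\<in>Basis. scale (cd b y) b)"
    using assms[OF lin_cd] by simp
  then show ?thesis by (simp only: sum_cd)
qed

definition trace :: "('h \<Rightarrow> 'h) \<Rightarrow> 'k"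
  where "trace M = (\<Sum>b\<in>Basis. cd b (M b))"

text \<open>Expanding \<open>N b\<close> in the basis gives a double sum that is symmetric under
  exchanging \<open>M\<close> and \<open>N\<close> together with the indices.\<close>

lemma trace_commute:
  assumes M: "lin scale M" and N: "lin scale N"
  shows "trace (\<lambda>x. M (N x)) = trace (\<lambda>x. N (M x))"
proof -
  have *: "trace (\<lambda>x. M (N x)) = (\<Sum>b\<in>Basis. \<Sum>c\<in>Basis. cd c (N b) * cd b (M c))"
    if "lin scale M" for M N
    unfolding trace_def
    by (simp add: linear_cd_expand[OF lin_comp[OF lin_cd that]])
  show ?thesis
    unfolding *[OF M] *[OF N] by (subst sum.swap) (simp add: mult.commute)
qed

lemma trace_sum: "trace (\<lambda>x. \<Sum>j\<in>J. M j x) = (\<Sum>j\<in>J. trace (M j))"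
  unfolding trace_def linear_sum[OF lin_cd] by (rule sum.swap)

lemma trace_scale: "trace (\<lambda>x. scale c (M x)) = c * trace M"
  unfolding trace_def by (simp add: linear_scale[OF lin_cd] sum_distrib_left)

lemma trace_scale_const: "lin (*) g \<Longrightarrow> trace (\<lambda>y. scale (g y) x) = g x"
  unfolding trace_def using linear_cd_expand[of "(*)" g x]
  by (simp add: linear_scale[OF lin_cd] mult.commute)

text \<open>The right hit action of the functional \<open>k\<close> on \<open>z\<close>, dual to
  left convolution by \<open>k\<close>.\<close>

definition translate :: "('h \<Rightarrow> 'k) \<Rightarrow> 'h \<Rightarrow> 'h"
  where "translate k z = sw scale (\<lambda>z1 z2. scale (k z1) z2) z"

lemma lin_translate:
  assumes k: "lin (*) k"
  shows "lin scale (translate k)"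
proof -
  note [lin_rules] = lin_comp[OF k]
  show ?thesis unfolding translate_def by (rule lin_rules)+
qed

lemma sw_trace:
  assumes "\<And>y. lin scale (\<lambda>x. M x y)"
  shows "sw (*) (\<lambda>x1 x2. f x1 * trace (M x2)) x
    = trace (\<lambda>y. sw scale (\<lambda>x1 x2. scale (f x1) (M x2 y)) x)"
  unfolding trace_def
  by (simp add: linear_out_sw[OF lin_cd] linear_scale[OF lin_cd] sum_distrib_left
      sw_sum[OF vector_space_field])

text \<open>
  Evaluation at \<open>g\<close> of the trace form of the map \<open>y \<mapsto> \<Sum> x S\<^sup>2(y\<^sub>1) g(y\<^sub>2)\<close>: the trivial module embeds
  into \<open>A \<otimes> A\<^sup>*\<close> for \<open>A = H\<^sup>*\<close>, and this is a free \<open>A\<close>-module.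
\<close>

definition trace_integral :: "('h \<Rightarrow> 'k) \<Rightarrow> 'h \<Rightarrow> 'k"
  where "trace_integral g x = trace (\<lambda>y. sw scale (\<lambda>a b. scale (g b) (x * S (S a))) y)"

lemma lin_trace_integral: "lin (*) (trace_integral g)"
  unfolding trace_integral_def[abs_def] trace_def by (rule lin_rules)+

text \<open>
  The reason is \<open>x\<^sub>1 \<otimes> x\<^sub>2 S\<^sup>2 y = \<Sum> x\<^sub>1 (S\<^sup>2 y\<^sub>2 S y\<^sub>1) \<otimes> x\<^sub>2 S\<^sup>2 y\<^sub>3 = \<Sum> (x S\<^sup>2 y\<^sub>2)\<^sub>1 S y\<^sub>1 \<otimes> (x S\<^sup>2 y\<^sub>2)\<^sub>2\<close>.
\<close>

lemma translate_antipode: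
  assumes f: "lin (*) f" and g: "lin (*) g"
  shows "sw scale (\<lambda>u v. translate (\<lambda>z. f (z * S u))
            (sw scale (\<lambda>a b. scale (g b) (x * S (S a))) v)) y
    = sw scale (\<lambda>x1 x2. scale (f x1) (sw scale (\<lambda>a b. scale (g b) (x2 * S (S a))) y)) x"
proof -
  note [lin_rules] = lin_comp[OF f] lin_comp[OF g]
  \<comment> \<open>For the four legs \<open>u\<close>, \<open>c\<close>, \<open>d\<close>,
    \<open>b\<close> of \<open>y\<close>, in this order, this is the fully expanded left-hand side.
    The calculation below regroups \<open>u\<close> with \<open>c\<close>, so that
    \<open>S (S c) * S u\<close> contracts.\<close>
  define K where "K u c d b =
    sw scale (\<lambda>x1 x2. scale (g b) (scale (f (x1 * (S (S c) * S u))) (x2 * S (S d)))) x" for u c d b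
  have K: "\<And>u c d. lin scale (K u c d)" "\<And>u c b. lin scale (\<lambda>d. K u c d b)"
    "\<And>u d b. lin scale (\<lambda>c. K u c d b)" "\<And>c d b. lin scale (\<lambda>u. K u c d b)"
    unfolding K_def by (rule lin_rules)+
  note [lin_rules] = K[THEN lin_comp]
  have T: "translate (\<lambda>z. f (z * S u)) (sw scale (\<lambda>a b. scale (g b) (x * S (S a))) v)
    = sw scale (\<lambda>a b. sw scale (\<lambda>c d. K u c d b) a) v" for u v
  proof -
    let ?k = "\<lambda>z. f (z * S u)"
    have k: "lin (*) ?k" by (rule lin_rules)+
    have "translate ?k (x * S (S a))
      = sw scale (\<lambda>x1 x2. sw scale (\<lambda>c d. scale (f (x1 * (S (S c) * S u))) (x2 * S (S d))) a) x" for a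
      unfolding translate_def
      by (subst sw_mult, (rule lin_rules)+, subst sw_antipode_twice, (rule lin_rules)+)
        (simp add: mult.assoc)
    then have "scale r (translate ?k (x * S (S a)))
      = sw scale (\<lambda>c d. sw scale (\<lambda>x1 x2. scale r (scale (f (x1 * (S (S c) * S u))) (x2 * S (S d)))) x) a"
      for a r
      by (simp only: sw_scale[OF vector_space_axioms] sw_swap[OF vector_space_axioms, where x=x])
    then show ?thesis
      by (simp only: linear_out_sw[OF lin_translate[OF k]] linear_scale[OF lin_translate[OF k]] K_def)
  qed
  define \<phi> where "\<phi> w z =
    sw scale (\<lambda>d b. sw scale (\<lambda>x1 x2. scale (g b) (scale (f (x1 * z)) (x2 * S (S d)))) x) w" for w z
  have \<phi>: "lin scale (\<phi> w)" for w unfolding \<phi>_def by (rule lin_rules)+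
  have \<phi>': "lin scale (\<lambda>w. \<phi> w 1)" unfolding \<phi>_def by (rule lin_rules)+
  have "sw scale (\<lambda>u v. sw scale (\<lambda>a b. sw scale (\<lambda>c d. K u c d b) a) v) y
    = sw scale (\<lambda>u v. sw scale (\<lambda>c w. sw scale (\<lambda>d b. K u c d b) w) v) y"
    by (subst sw_coassoc) ((rule lin_rules K)+, rule refl)
  also have "\<dots> = sw scale (\<lambda>m w. sw scale (\<lambda>u c. sw scale (\<lambda>d b. K u c d b) w) m) y"
    by (rule sw_coassoc[symmetric]) (rule lin_rules K)+
  also have "\<dots> = sw scale (\<lambda>m w. sw scale (\<lambda>u c. \<phi> w (S (S c) * S u)) m) y"
    by (simp only: K_def \<phi>_def)
  also have "\<dots> = sw scale (\<lambda>m w. scale (\<epsilon> m) (\<phi> w 1)) y"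
    by (simp only: sw_antipode_antipode_left[OF \<phi>])
  also have "\<dots> = \<phi> y 1"
    by (rule sw_counit_left[OF \<phi>'])
  also have "\<dots> = sw scale (\<lambda>x1 x2. sw scale (\<lambda>d b. scale (f x1) (scale (g b) (x2 * S (S d)))) y) x"
    unfolding \<phi>_def by (subst sw_swap[OF vector_space_axioms]) (simp add: mult.commute)
  finally show ?thesis
    unfolding T sw_scale[OF vector_space_axioms] .
qed

text \<open>Convolution with \<open>f\<close> turns the traced map into a sum of maps
  \<open>translate (fs j)\<close> after \<open>M\<close> after \<open>translate (cd j)\<close>.
  Cyclicity of the trace brings the two translations together, and their sum over the basis is
  \<open>f 1\<close> times the identity.\<close>

lemma trace_integral:
  assumes f: "lin (*) f" and g: "lin (*) g"
  shows "sw (*) (\<lambda>a b. f a * trace_integral g b) x = f 1 * trace_integral g x"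
proof -
  note [lin_rules] = lin_comp[OF f] lin_comp[OF g]
  define M where "M v = sw scale (\<lambda>a b. scale (g b) (x * S (S a))) v" for v
  define fs where "fs j z = f (z * S j)" for j z
  have M: "lin scale M" unfolding M_def by (rule lin_rules)+
  have fs: "lin (*) (fs j)" for j unfolding fs_def by (rule lin_rules)+
  \<comment> \<open>The leg \<open>u\<close> occurs linearly, so expanding it in the basis separates
    it from \<open>v\<close> and turns it into a translation by \<open>cd j\<close>.\<close>
  have *: "sw scale (\<lambda>u v. translate (fs u) (M v)) y
    = (\<Sum>j\<in>Basis. translate (fs j) (M (translate (cd j) y)))" for y
  proof -
    have "translate (fs u) w = (\<Sum>j\<in>Basis. scale (cd j u) (translate (fs j) w))" for u w
    proof -
      have "lin scale (\<lambda>u. translate (fs u) w)"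
        unfolding translate_def fs_def by (rule lin_rules)+
      from linear_cd_expand[OF this] show ?thesis by simp
    qed
    note tr = this
    have "sw scale (\<lambda>u v. translate (fs u) (M v)) y
      = sw scale (\<lambda>u v. \<Sum>j\<in>Basis. scale (cd j u) (translate (fs j) (M v))) y"
      by (subst tr) (rule refl)
    also have "\<dots> = (\<Sum>j\<in>Basis. translate (fs j) (M (translate (cd j) y)))"
      unfolding sw_sum[OF vector_space_axioms]
      by (simp add: translate_def[of "cd _"] linear_out_sw[OF M] linear_scale[OF M]
          linear_out_sw[OF lin_translate[OF fs]] linear_scale[OF lin_translate[OF fs]])
    finally show ?thesis .
  qed
  \<comment> \<open>Summing over \<open>j\<close> reassembles
    \<open>f (y\<^sub>1 * S y\<^sub>2)\<close> with remaining leg \<open>y\<^sub>3\<close>, to which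
    the right antipode axiom applies.\<close>
  have **: "(\<Sum>j\<in>Basis. translate (cd j) (translate (fs j) y)) = scale (f 1) y" for y
  proof -
    have "translate (cd j) (translate (fs j) y)
      = sw scale (\<lambda>a b. sw scale (\<lambda>c d. scale (f (a * S j)) (scale (cd j c) d)) b) y" for j
      unfolding sw_scale[OF vector_space_axioms]
      by (simp add: translate_def[of "fs _"] linear_out_sw[OF lin_translate[OF lin_cd]]
          linear_scale[OF lin_translate[OF lin_cd]] fs_def translate_def[of "cd _", symmetric])
    then have "(\<Sum>j\<in>Basis. translate (cd j) (translate (fs j) y))
      = sw scale (\<lambda>a b. sw scale (\<lambda>c d. \<Sum>j\<in>Basis. scale (f (a * S j)) (scale (cd j c) d)) b) y"
      by (simp only: sw_sum[OF vector_space_axioms])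
    also have "\<dots> = sw scale (\<lambda>a b. sw scale (\<lambda>c d. scale (f (a * S c)) d) b) y"
    proof -
      have "(\<Sum>j\<in>Basis. scale (f (a * S j)) (scale (cd j c) d)) = scale (f (a * S c)) d" for a c d
      proof -
        have "lin scale (\<lambda>c. scale (f (a * S c)) d)" by (rule lin_rules)+
        from linear_cd_expand[OF this, of c] show ?thesis by (simp add: mult.commute)
      qed
      then show ?thesis by simp
    qed
    also have "\<dots> = sw scale (\<lambda>u d. sw scale (\<lambda>a c. scale (f (a * S c)) d) u) y"
      by (rule sw_coassoc[symmetric]) (rule lin_rules)+
    also have "\<dots> = sw scale (\<lambda>u d. scale (\<epsilon> u) (scale (f 1) d)) y"
      by (subst sw_antipode_right) ((rule lin_rules f)+, rule refl)
    also have "\<dots> = scale (f 1) y"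
      by (rule sw_counit_left) (rule lin_rules)+
    finally show ?thesis .
  qed
  have "sw (*) (\<lambda>a b. f a * trace_integral g b) x
    = trace (\<lambda>y. sw scale (\<lambda>x1 x2. scale (f x1) (sw scale (\<lambda>a b. scale (g b) (x2 * S (S a))) y)) x)"
    unfolding trace_integral_def by (rule sw_trace) (rule lin_rules)+
  also have "\<dots> = trace (\<lambda>y. sw scale (\<lambda>u v. translate (fs u) (M v)) y)"
    by (simp only: translate_antipode[OF f g, symmetric] fs_def[abs_def] M_def)
  also have "\<dots> = (\<Sum>j\<in>Basis. trace (\<lambda>y. translate (fs j) (M (translate (cd j) y))))"
    unfolding * by (rule trace_sum)
  also have "\<dots> = (\<Sum>j\<in>Basis. trace (\<lambda>y. M (translate (cd j) (translate (fs j) y))))"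
    by (rule sum.cong[OF refl], rule trace_commute[OF lin_translate[OF fs]])
      (rule lin_comp[OF M] lin_translate lin_cd)+
  also have "\<dots> = trace (\<lambda>y. M (\<Sum>j\<in>Basis. translate (cd j) (translate (fs j) y)))"
    by (simp only: trace_sum linear_sum[OF M])
  also have "\<dots> = trace (\<lambda>y. scale (f 1) (M y))"
    by (simp only: ** linear_scale[OF M])
  also have "\<dots> = f 1 * trace_integral g x"
    by (simp add: trace_scale trace_integral_def M_def[abs_def])
  finally show ?thesis .
qed

text \<open>This forces some trace form to be non-zero. The basis sum turns the traced map into
  \<open>\<Sum> S y\<^sub>2 * S\<^sup>2 y\<^sub>1 = \<epsilon> y\<close>, a map of rank one with
  trace \<open>\<epsilon> 1\<close>.\<close>

lemma sum_trace_integral: "(\<Sum>j\<in>Basis. trace_integral (cd j) (S j)) = 1"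
proof -
  have "(\<Sum>j\<in>Basis. scale (cd j b) (S j * S (S a))) = S b * S (S a)" for a b
    by (rule linear_cd_expand) (rule lin_rules)+
  then have "(\<Sum>j\<in>Basis. trace_integral (cd j) (S j)) = trace (\<lambda>y. sw scale (\<lambda>a b. S b * S (S a)) y)"
    unfolding trace_integral_def trace_sum[symmetric] sw_sum[OF vector_space_axioms, symmetric]
    by simp
  also have "\<dots> = trace (\<lambda>y. scale (\<epsilon> y) 1)"
    by (simp add: sw_antipode_antipode_right[OF lin_id])
  also have "\<dots> = 1"
    by (simp add: trace_scale_const[OF counit_linear] counit_one)
  finally show ?thesis .
qed

lemma ex_nonzero_integral:
  obtains \<Lambda> x where "lin (*) \<Lambda>" "\<Lambda> x \<noteq> 0"
    "\<And>f x. lin (*) f \<Longrightarrow> sw (*) (\<lambda>a b. f a * \<Lambda> b) x = f 1 * \<Lambda> x"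
proof -
  have "\<exists>j. trace_integral (cd j) (S j) \<noteq> 0"
  proof (rule ccontr)
    assume "\<nexists>j. trace_integral (cd j) (S j) \<noteq> 0"
    then show False using sum_trace_integral by simp
  qed
  then obtain j where "trace_integral (cd j) (S j) \<noteq> 0" ..
  then show ?thesis
    using that[OF lin_trace_integral _ trace_integral[OF _ lin_cd]] by blast
qed

end

section \<open>Non-singularity and integrals\<close>

context coalgebra
begin

abbreviation dual :: "('c \<Rightarrow> 'k) ring"
  where "dual \<equiv> dual_algebra scale \<Delta> \<epsilon>"

lemma carrier_dual: "carrier dual = {f. lin (*) f}"
  and zero_dual: "\<zero>\<^bsub>dual\<^esub> = (\<lambda>c. 0)"
  and add_dual: "f \<oplus>\<^bsub>dual\<^esub> g = (\<lambda>c. f c + g c)"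
  and mult_dual: "f \<otimes>\<^bsub>dual\<^esub> g = sw (*) (\<lambda>a b. f a * g b)"
  by (auto simp: dual_algebra_def sw_def fun_eq_iff)

lemma lin_zero_fun: "lin (*) (\<lambda>c. 0)"
  by (simp add: Vector_Spaces.linear_iff vector_space_axioms vector_space_field)

lemma lin_uminus_fun: "lin (*) f \<Longrightarrow> lin (*) (\<lambda>c. - f c)"
  by (simp add: Vector_Spaces.linear_iff)

lemma abelian_group_dual: "abelian_group dual"
proof (rule abelian_groupI)
  fix f
  assume "f \<in> carrier dual"
  then show "\<exists>g\<in>carrier dual. g \<oplus>\<^bsub>dual\<^esub> f = \<zero>\<^bsub>dual\<^esub>"
    by (intro bexI[of _ "\<lambda>c. - f c"]) (auto simp: carrier_dual zero_dual add_dual lin_uminus_fun)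
qed (auto simp: carrier_dual zero_dual add_dual lin_add lin_zero_fun algebra_simps)

lemma a_inv_dual:
  assumes "f \<in> carrier dual"
  shows "\<ominus>\<^bsub>dual\<^esub> f = (\<lambda>c. - f c)"
  by (rule abelian_group.minus_equality[OF abelian_group_dual])
    (use assms in \<open>auto simp: carrier_dual zero_dual add_dual lin_uminus_fun\<close>)

end

context fd_hopf_algebra
begin

text \<open>Evaluation at \<open>1\<close> is multiplicative for convolution because
  \<open>1\<close> is grouplike.\<close>

lemma left_ideal_augmentation: "left_ideal dual {f. lin (*) f \<and> f 1 = 0}"
  unfolding left_ideal_def
proof (intro conjI ballI)
  show "additive_subgroup {f. lin (*) f \<and> f 1 = 0} dual"
  proof (intro additive_subgroup.intro group.subgroupI abelian_group.a_group abelian_group_dual)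
    show "{f. lin (*) f \<and> f 1 = 0} \<noteq> {}" using lin_zero_fun by auto
  next
    fix f
    assume f: "f \<in> {f. lin (*) f \<and> f 1 = 0}"
    then have "\<ominus>\<^bsub>dual\<^esub> f = (\<lambda>c. - f c)"
      by (intro a_inv_dual) (simp add: carrier_dual)
    then show "inv\<^bsub>add_monoid dual\<^esub> f \<in> {f. lin (*) f \<and> f 1 = 0}"
      using f by (simp add: a_inv_def lin_uminus_fun)
  qed (auto simp: carrier_dual add_dual lin_add)
next
  fix r f
  assume r: "r \<in> carrier dual" and f: "f \<in> {f. lin (*) f \<and> f 1 = 0}"
  then have \<beta>: "\<And>b. lin (*) (\<lambda>a. r a * f b)" "\<And>a. lin (*) (\<lambda>b. r a * f b)"
    by (auto simp: carrier_dual intro: lin_rules)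
  show "r \<otimes>\<^bsub>dual\<^esub> f \<in> {f. lin (*) f \<and> f 1 = 0}"
    using linear_sw[OF \<beta>] sw_one[OF \<beta>] f by (simp add: mult_dual)
qed

text \<open>
  The augmentation ideal annihilates a non-zero integral, so it is not essential; a left ideal
  meeting it trivially consists of integrals that do not vanish at \<open>1\<close>.
\<close>

lemma nonsingular_normalized_integral:
  assumes nonsing: "nonsingular_coalgebra scale \<Delta> \<epsilon>"
  obtains j where "lin (*) j" "j 1 = 1"
    "\<And>f x. lin (*) f \<Longrightarrow> sw (*) (\<lambda>a b. f a * j b) x = f 1 * j x"
proof -
  obtain \<Lambda> x0 where \<Lambda>: "lin (*) \<Lambda>" "\<Lambda> x0 \<noteq> 0"
    and int: "\<And>f x. lin (*) f \<Longrightarrow> sw (*) (\<lambda>a b. f a * \<Lambda> b) x = f 1 * \<Lambda> x"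
    by (rule ex_nonzero_integral) (rule that)
  define M where "M = {f. lin (*) f \<and> f 1 = 0}"
  \<comment> \<open>The product of \<open>f\<close> with the integral is \<open>f 1\<close> times
    the integral, and the integral does not vanish at \<open>x0\<close>.\<close>
  have "left_annihilator dual \<Lambda> = M"
    using \<Lambda>(2) unfolding left_annihilator_def carrier_dual mult_dual zero_dual M_def
    by (auto simp: fun_eq_iff int)
  moreover have "\<not> essential_left_ideal dual (left_annihilator dual \<Lambda>)"
    using nonsing \<Lambda> unfolding nonsingular_coalgebra_def left_nonsingular_ring_def
    by (auto simp: carrier_dual zero_dual fun_eq_iff)
  ultimately obtain J where J: "left_ideal dual J" "J \<noteq> {\<zero>\<^bsub>dual\<^esub>}" "M \<inter> J = {\<zero>\<^bsub>dual\<^esub>}"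
    using left_ideal_augmentation unfolding essential_left_ideal_def M_def by auto
  have Jsub: "J \<subseteq> carrier dual"
    and Jmult: "\<And>r f. r \<in> carrier dual \<Longrightarrow> f \<in> J \<Longrightarrow> r \<otimes>\<^bsub>dual\<^esub> f \<in> J"
    using J(1) by (auto simp: left_ideal_def dest: additive_subgroup.a_subset)
  have "\<zero>\<^bsub>dual\<^esub> \<in> J" using J(3) by auto
  then obtain j where j: "j \<in> J" "j \<noteq> \<zero>\<^bsub>dual\<^esub>" using J(2) by auto
  have lin_j: "lin (*) j" using j(1) Jsub by (auto simp: carrier_dual)
  have j1: "j 1 \<noteq> 0"
    using j J(3) lin_j by (auto simp: M_def)
  have j_int: "sw (*) (\<lambda>a b. f a * j b) x = f 1 * j x" if f: "lin (*) f" for f x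
  proof -
    \<comment> \<open>Subtracting a multiple of the unit \<open>\<epsilon>\<close> moves
      \<open>f\<close> into the augmentation ideal. The product of \<open>h\<close> and
      \<open>j\<close> then lies in both \<open>J\<close> and \<open>M\<close>, hence is
      zero.\<close>
    define h where "h a = f a - f 1 * \<epsilon> a" for a
    have h: "lin (*) h" unfolding h_def by (intro lin_rules f counit_linear)
    have \<beta>: "\<And>b. lin (*) (\<lambda>a. h a * j b)" "\<And>a. lin (*) (\<lambda>b. h a * j b)"
      by (intro lin_rules h lin_j)+
    have "h \<otimes>\<^bsub>dual\<^esub> j \<in> J"
      by (rule Jmult) (use h j in \<open>auto simp: carrier_dual\<close>)
    moreover have "h \<otimes>\<^bsub>dual\<^esub> j \<in> M"
      using linear_sw[OF \<beta>] sw_one[OF \<beta>] by (simp add: M_def mult_dual h_def counit_one)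
    ultimately have "h \<otimes>\<^bsub>dual\<^esub> j = \<zero>\<^bsub>dual\<^esub>" using J(3) by blast
    then have 0: "sw (*) (\<lambda>a b. h a * j b) x = 0"
      by (simp add: mult_dual zero_dual fun_eq_iff)
    have "sw (*) (\<lambda>a b. f a * j b) x
      = sw (*) (\<lambda>a b. h a * j b) x + f 1 * sw (*) (\<lambda>a b. \<epsilon> a * j b) x"
      by (simp add: h_def sw_sum_form sum_distrib_left sum.distrib[symmetric] algebra_simps)
    then show ?thesis
      by (simp add: 0 sw_counit_left[OF lin_j])
  qed
  have *: "sw (*) (\<lambda>a b. f a * (inverse (j 1) * j b)) x = inverse (j 1) * sw (*) (\<lambda>a b. f a * j b) x" for f x
    by (subst sw_scale[OF vector_space_field, symmetric]) (simp add: mult.left_commute)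
  show ?thesis
    by (rule that[of "\<lambda>x. inverse (j 1) * j x"])
      (use j1 j_int in \<open>auto intro: lin_rules lin_j simp: *\<close>)
qed

end

section \<open>Complements of subcoalgebras\<close>

context coalgebra
begin

lemma scale_sw: "scale (sw (*) \<beta> x) y = sw scale (\<lambda>a b. scale (\<beta> a b) y) x"
  by (simp add: sw_sum_form scale_sum_left)

lemma sw_mem:
  assumes "subspace U" "\<And>a b. \<beta> a b \<in> U"
  shows "sw scale \<beta> x \<in> U"
  unfolding sw_sum_form by (intro subspace_sum subspace_scale assms)

lemma subcoalgebra_rep:
  assumes "subcoalgebra scale \<Delta> D" "x \<in> D"
  obtains p where "\<Delta> x = tensor2_class scale p" "Poly_Mapping.keys p \<subseteq> D \<times> D"
  using assms unfolding subcoalgebra_def by blast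

text \<open>The representative behind \<open>sw\<close> need not be supported on
  \<open>D \<times> D\<close>. Bilinearity allows passing to one that is, after which only values on
  \<open>D\<close> matter; the same device gives \<open>subcoalgebra_sw_mem\<close>.\<close>

lemma subcoalgebra_sw_cong:
  assumes D: "subcoalgebra scale \<Delta> D" "x \<in> D"
    and \<beta>: "\<And>b. lin t (\<lambda>a. \<beta> a b)" "\<And>a. lin t (\<beta> a)"
    and \<gamma>: "\<And>b. lin t (\<lambda>a. \<gamma> a b)" "\<And>a. lin t (\<gamma> a)"
    and eq: "\<And>a b. a \<in> D \<Longrightarrow> b \<in> D \<Longrightarrow> \<beta> a b = \<gamma> a b"
  shows "sw t \<beta> x = sw t \<gamma> x"
proof -
  obtain p where p: "\<Delta> x = tensor2_class scale p" "Poly_Mapping.keys p \<subseteq> D \<times> D"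
    by (rule subcoalgebra_rep[OF D])
  show ?thesis
    unfolding sw_class[OF \<beta> p(1)] sw_class[OF \<gamma> p(1)] free_extend_def
    by (rule sum.cong) (use p(2) eq in auto)
qed

lemma subcoalgebra_sw_mem:
  assumes D: "subcoalgebra scale \<Delta> D" "x \<in> D"
    and \<beta>: "\<And>b. lin scale (\<lambda>a. \<beta> a b)" "\<And>a. lin scale (\<beta> a)"
    and mem: "\<And>a b. a \<in> D \<Longrightarrow> b \<in> D \<Longrightarrow> \<beta> a b \<in> D"
  shows "sw scale \<beta> x \<in> D"
proof -
  obtain p where p: "\<Delta> x = tensor2_class scale p" "Poly_Mapping.keys p \<subseteq> D \<times> D"
    by (rule subcoalgebra_rep[OF D])
  show ?thesis
    unfolding sw_class[OF \<beta> p(1)] free_extend_def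
    by (intro subspace_sum subspace_scale) (use p(2) mem D(1) in \<open>auto simp: subcoalgebra_def\<close>)
qed

end

section \<open>The coseparability form and averaged projections\<close>

locale integral_hopf_algebra = fd_hopf_algebra scale \<Delta> \<epsilon> S Basis
  for scale :: "'k::field \<Rightarrow> 'h::ring_1 \<Rightarrow> 'h" and \<Delta> \<epsilon> S Basis +
  fixes j :: "'h \<Rightarrow> 'k"
  assumes integral_linear: "lin (*) j"
    and integral_one: "j 1 = 1"
    and integral: "lin (*) f \<Longrightarrow> sw (*) (\<lambda>a b. f a * j b) x = f 1 * j x"
begin

lemmas lin_integral [lin_rules] = lin_comp[OF integral_linear]

definition \<tau> :: "'h \<Rightarrow> 'h \<Rightarrow> 'k"
  where "\<tau> x y = j (x * S y)"

lemma lin_\<tau> [lin_rules]: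
  "lin scale g \<Longrightarrow> lin (*) (\<lambda>x. \<tau> (g x) b)"
  "lin scale g \<Longrightarrow> lin (*) (\<lambda>x. \<tau> a (g x))"
  unfolding \<tau>_def by (rule lin_rules | assumption)+

lemma sw_\<tau>: "sw (*) \<tau> x = \<epsilon> x"
  using sw_antipode_right[OF integral_linear, of x] by (simp add: \<tau>_def[abs_def] integral_one)

text \<open>The integral property at \<open>x * S a\<close> spreads \<open>\<tau> x a\<close> over
  the legs of \<open>x\<close> and \<open>a\<close>. With \<open>a\<close> the first leg of
  \<open>y\<close> and \<open>b\<close> the second, a factor \<open>S y\<^sub>2 * y\<^sub>3\<close>
  appears and contracts. Testing against functionals \<open>f\<close> brings the claim into the
  scalar form of \<open>integral\<close>.\<close>

lemma \<tau>_balanced: "sw scale (\<lambda>a b. scale (\<tau> b y) a) x = sw scale (\<lambda>a b. scale (\<tau> x a) b) y"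
proof (rule eq_if_functionals_eq)
  fix f :: "'h \<Rightarrow> 'k"
  assume f: "lin (*) f"
  note [lin_rules] = lin_comp[OF f]
  \<comment> \<open>The integral property is used for the functional sending \<open>p\<close> to
    \<open>f (p * b)\<close>, whose value at \<open>1\<close> is \<open>f b\<close>.\<close>
  have *: "\<tau> x a * f b = sw (*) (\<lambda>p q. sw (*) (\<lambda>x1 x2. f (x1 * (S q * b)) * j (x2 * S p)) x) a" for a b
  proof -
    have "\<tau> x a * f b = sw (*) (\<lambda>p q. f (p * b) * j q) (x * S a)"
      by (subst integral[of "\<lambda>p. f (p * b)"]) ((rule lin_rules)+, simp add: \<tau>_def)
    also have "\<dots> = sw (*) (\<lambda>x1 x2. sw (*) (\<lambda>p q. f (x1 * (S q * b)) * j (x2 * S p)) a) x"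
      by (subst sw_mult, (rule lin_rules)+, subst sw_antipode, (rule lin_rules)+)
        (simp add: mult.assoc)
    finally show ?thesis by (simp only: sw_swap[OF vector_space_field, where x=x])
  qed
  define \<phi> where "\<phi> p z = sw (*) (\<lambda>x1 x2. f (x1 * z) * j (x2 * S p)) x" for p z
  have \<phi>: "lin (*) (\<phi> p)" "lin (*) (\<lambda>p. \<phi> p z)" for p z
    unfolding \<phi>_def by (rule lin_rules)+
  have "f (sw scale (\<lambda>a b. scale (\<tau> x a) b) y) = sw (*) (\<lambda>a b. \<tau> x a * f b) y"
    by (simp add: linear_out_sw[OF f] linear_scale[OF f])
  also have "\<dots> = sw (*) (\<lambda>a b. sw (*) (\<lambda>p q. \<phi> p (S q * b)) a) y"
    by (simp only: * \<phi>_def)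
  also have "\<dots> = sw (*) (\<lambda>p w. sw (*) (\<lambda>q b. \<phi> p (S q * b)) w) y"
    by (rule sw_coassoc) (rule lin_rules \<phi>[THEN lin_comp])+
  also have "\<dots> = sw (*) (\<lambda>p w. \<epsilon> w * \<phi> p 1) y"
    by (simp only: sw_antipode_left[OF \<phi>(1)])
  also have "\<dots> = \<phi> y 1"
    by (rule sw_counit_right[OF \<phi>(2)])
  also have "\<dots> = f (sw scale (\<lambda>a b. scale (\<tau> b y) a) x)"
    by (simp add: linear_out_sw[OF f] linear_scale[OF f] \<phi>_def \<tau>_def mult.commute)
  finally show "f (sw scale (\<lambda>a b. scale (\<tau> b y) a) x) = f (sw scale (\<lambda>a b. scale (\<tau> x a) b) y)" ..
qed

lemma ex_projection:
  assumes "subspace D"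
  obtains \<pi> where "lin scale \<pi>" "\<And>x. \<pi> x \<in> D" "\<And>x. x \<in> D \<Longrightarrow> \<pi> x = x"
proof -
  interpret P: vector_space_pair scale scale by unfold_locales
  from P.linear_exists_left_inverse_on[OF lin_id assms] show ?thesis
    using that by (auto simp: image_subset_iff)
qed

text \<open>The element \<open>c\<close> is the central idempotent of \<open>H\<^sup>*\<close> attached to the subcoalgebra \<open>D\<close>.\<close>

lemma ex_central_idempotent:
  assumes D: "subcoalgebra scale \<Delta> D"
  obtains c where "lin (*) c" "\<And>x. x \<in> D \<Longrightarrow> c x = \<epsilon> x"
    "\<And>x. sw scale (\<lambda>a b. scale (c a) b) x \<in> D"
    "\<And>x. sw scale (\<lambda>a b. scale (c b) a) x = sw scale (\<lambda>a b. scale (c a) b) x"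
proof -
  have sub: "subspace D" using D by (simp add: subcoalgebra_def)
  obtain \<pi> where \<pi>: "lin scale \<pi>" "\<And>x. \<pi> x \<in> D" "\<And>x. x \<in> D \<Longrightarrow> \<pi> x = x"
    using ex_projection[OF sub] by blast
  note [lin_rules] = lin_comp[OF \<pi>(1)]
  \<comment> \<open>The projection is averaged on either leg: \<open>e\<close> yields an action
    \<open>E\<close> from one side with values in \<open>D\<close>, \<open>e'\<close> an action
    \<open>E'\<close> from the other side. The two functionals are shown to agree only
    afterwards.\<close>
  define e where "e x = sw (*) (\<lambda>a b. \<tau> (\<pi> a) b) x" for x
  define e' where "e' x = sw (*) (\<lambda>a b. \<tau> a (\<pi> b)) x" for x
  have e: "lin (*) e" and e': "lin (*) e'"
    unfolding e_def e'_def by (rule lin_rules)+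
  note [lin_rules] = lin_comp[OF e] lin_comp[OF e']
  define E where "E x = sw scale (\<lambda>a b. scale (e a) b) x" for x
  define E' where "E' x = sw scale (\<lambda>a b. scale (e' b) a) x" for x
  have eD: "e x = \<epsilon> x" if "x \<in> D" for x
    unfolding e_def sw_\<tau>[symmetric]
    by (rule subcoalgebra_sw_cong[OF D that]) ((rule lin_rules)+, simp add: \<pi>)
  have e'D: "e' x = \<epsilon> x" if "x \<in> D" for x
    unfolding e'_def sw_\<tau>[symmetric]
    by (rule subcoalgebra_sw_cong[OF D that]) ((rule lin_rules)+, simp add: \<pi>)
  have E_mem: "E x \<in> D" for x
  proof -
    \<comment> \<open>Balancing moves the comultiplication from the second argument of
      \<open>\<tau>\<close> to \<open>\<pi> p\<close>, which lies in \<open>D\<close> together with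
      its legs.\<close>
    have "E x = sw scale (\<lambda>p w. sw scale (\<lambda>q b. scale (\<tau> (\<pi> p) q) b) w) x"
      unfolding E_def e_def scale_sw by (rule sw_coassoc) (rule lin_rules)+
    also have "\<dots> \<in> D"
      unfolding \<tau>_balanced[symmetric]
      by (intro sw_mem[OF sub] subcoalgebra_sw_mem[OF D \<pi>(2)] lin_rules)
        (simp add: subspace_scale[OF sub])
    finally show ?thesis .
  qed
  have E'_mem: "E' x \<in> D" for x
  proof -
    have "E' x = sw scale (\<lambda>w q. sw scale (\<lambda>a p. scale (\<tau> p (\<pi> q)) a) w) x"
      unfolding E'_def e'_def scale_sw by (rule sw_coassoc[symmetric]) (rule lin_rules)+
    also have "\<dots> \<in> D"
      unfolding \<tau>_balanced
      by (intro sw_mem[OF sub] subcoalgebra_sw_mem[OF D \<pi>(2)] lin_rules)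
        (simp add: subspace_scale[OF sub])
    finally show ?thesis .
  qed
  \<comment> \<open>Both sides equal the convolution product of \<open>e\<close> and
    \<open>e'\<close>, since each functional is a counit on \<open>D\<close> and \<open>E\<close>,
    \<open>E'\<close> map into \<open>D\<close>.\<close>
  have "e x = e' x" for x
  proof -
    have "e x = \<epsilon> (E x)"
      using sw_counit_right[OF e, of x]
      by (simp add: E_def linear_out_sw[OF counit_linear] linear_scale[OF counit_linear] mult.commute)
    also have "\<dots> = e' (E x)" by (simp add: e'D E_mem)
    also have "\<dots> = e (E' x)"
      by (simp add: E_def E'_def linear_out_sw[OF e] linear_scale[OF e] linear_out_sw[OF e']
          linear_scale[OF e'] mult.commute)
    also have "\<dots> = \<epsilon> (E' x)" by (simp add: eD E'_mem)
    also have "\<dots> = e' x"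
      using sw_counit_left[OF e', of x]
      by (simp add: E'_def linear_out_sw[OF counit_linear] linear_scale[OF counit_linear] mult.commute)
    finally show ?thesis .
  qed
  then have ee: "e' = e" by auto
  have linE: "lin scale E" and linE': "lin scale E'"
    unfolding E_def E'_def by (rule lin_rules)+
  \<comment> \<open>Centrality: the two actions commute by coassociativity, and each is the identity
    on \<open>D\<close>, which contains the image of the other.\<close>
  have "E' x = E x" for x
  proof -
    have "E x = sw scale (\<lambda>a b. scale (\<epsilon> b) a) (E x)"
      by (rule sw_counit_right[OF lin_id, symmetric])
    also have "\<dots> = E' (E x)"
      unfolding E'_def by (rule subcoalgebra_sw_cong[OF D E_mem]) ((rule lin_rules)+, simp add: e'D)
    also have "\<dots> = sw scale (\<lambda>a b. scale (e a) (E' b)) x"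
      by (simp add: E_def linear_out_sw[OF linE'] linear_scale[OF linE'])
    also have "\<dots> = sw scale (\<lambda>a b. sw scale (\<lambda>p q. scale (e a) (scale (e' q) p)) b) x"
      unfolding E'_def sw_scale[OF vector_space_axioms] ..
    also have "\<dots> = sw scale (\<lambda>b q. sw scale (\<lambda>a p. scale (e a) (scale (e' q) p)) b) x"
      by (rule sw_coassoc[symmetric]) (rule lin_rules)+
    also have "\<dots> = sw scale (\<lambda>b q. scale (e' q) (E b)) x"
      by (simp add: E_def sw_scale[symmetric] vector_space_axioms mult.commute)
    also have "\<dots> = E (E' x)"
      by (simp add: E'_def linear_out_sw[OF linE] linear_scale[OF linE])
    also have "\<dots> = sw scale (\<lambda>a b. scale (\<epsilon> a) b) (E' x)"
      unfolding E_def by (rule subcoalgebra_sw_cong[OF D E'_mem]) ((rule lin_rules)+, simp add: eD)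
    also have "\<dots> = E' x"
      by (rule sw_counit_left[OF lin_id])
    finally show ?thesis ..
  qed
  then show ?thesis
    using that[OF e eD] E_mem unfolding E_def E'_def ee by blast
qed

text \<open>\<open>F\<close> is the action of the complementary idempotent
  \<open>\<epsilon> - c\<close>. Centrality lets it act on either leg of the comultiplication, and
  idempotence then lets it act on both. This compatibility is stated through pairs of
  functionals.\<close>

lemma ex_complementary_projection:
  assumes D: "subcoalgebra scale \<Delta> D"
  obtains F where "lin scale F" "\<And>x. x \<in> D \<Longrightarrow> F x = 0" "\<And>x. x - F x \<in> D"
    "\<And>f g x. lin (*) f \<Longrightarrow> lin (*) g \<Longrightarrow>
      sw (*) (\<lambda>a b. f a * g b) (F x) = sw (*) (\<lambda>a b. f (F a) * g (F b)) x"
proof -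
  obtain c where c: "lin (*) c" "\<And>x. x \<in> D \<Longrightarrow> c x = \<epsilon> x"
    "\<And>x. sw scale (\<lambda>a b. scale (c a) b) x \<in> D"
    "\<And>x. sw scale (\<lambda>a b. scale (c b) a) x = sw scale (\<lambda>a b. scale (c a) b) x"
    using ex_central_idempotent[OF D] by blast
  note [lin_rules] = lin_comp[OF c(1)]
  define E where "E x = sw scale (\<lambda>a b. scale (c a) b) x" for x
  define F where "F x = x - E x" for x
  have E': "E x = sw scale (\<lambda>a b. scale (c b) a) x" for x
    by (simp add: E_def c)
  have E: "lin scale E" unfolding E_def by (rule lin_rules)+
  have F: "lin scale F" unfolding F_def by (intro lin_rules E)
  note [lin_rules] = lin_comp[OF E] lin_comp[OF F]
  have ED: "E x = x" if "x \<in> D" for x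
  proof -
    have "E x = sw scale (\<lambda>a b. scale (\<epsilon> a) b) x"
      unfolding E_def by (rule subcoalgebra_sw_cong[OF D that]) ((rule lin_rules)+, simp add: c)
    then show ?thesis by (simp add: sw_counit_left[OF lin_id])
  qed
  have FD: "F x = 0" if "x \<in> D" for x using ED[OF that] by (simp add: F_def)
  have E_mem: "E x \<in> D" for x by (simp add: E_def c)
  have FF: "F (F x) = F x" for x
    using linear_diff[OF F, of x "E x"] FD[OF E_mem] by (simp add: F_def)
  \<comment> \<open>The first identity rests on \<open>E x = \<Sum> c x\<^sub>1 x\<^sub>2\<close>,
    the second on \<open>E x = \<Sum> c x\<^sub>2 x\<^sub>1\<close>.\<close>
  have sw_F: "sw (*) \<beta> (F x) = sw (*) (\<lambda>a b. \<beta> (F a) b) x"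
      "sw (*) \<beta> (F x) = sw (*) (\<lambda>a b. \<beta> a (F b)) x"
    if \<beta>: "\<And>b. lin (*) (\<lambda>a. \<beta> a b)" "\<And>a. lin (*) (\<beta> a)" for \<beta> x
  proof -
    note [lin_rules] = lin_comp[OF \<beta>(1)] lin_comp[OF \<beta>(2)]
    note L = linear_sw[OF \<beta>]
    have "sw (*) \<beta> (E x) = sw (*) (\<lambda>a w. sw (*) (\<lambda>p q. c a * \<beta> p q) w) x"
      by (simp add: E_def linear_out_sw[OF L] linear_scale[OF L] sw_scale vector_space_field)
    also have "\<dots> = sw (*) (\<lambda>u q. sw (*) (\<lambda>a p. c a * \<beta> p q) u) x"
      by (rule sw_coassoc[symmetric]) (rule lin_rules)+
    also have "\<dots> = sw (*) (\<lambda>u q. \<beta> (E u) q) x"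
      by (simp add: E_def linear_out_sw[OF \<beta>(1)] linear_scale[OF \<beta>(1)])
    finally show "sw (*) \<beta> (F x) = sw (*) (\<lambda>a b. \<beta> (F a) b) x"
      by (simp add: F_def linear_diff[OF L] linear_diff[OF \<beta>(1)] sw_diff vector_space_field)
    have "sw (*) \<beta> (E x) = sw (*) (\<lambda>w b. sw (*) (\<lambda>p q. c b * \<beta> p q) w) x"
      by (simp add: E' linear_out_sw[OF L] linear_scale[OF L] sw_scale vector_space_field)
    also have "\<dots> = sw (*) (\<lambda>p u. sw (*) (\<lambda>q b. c b * \<beta> p q) u) x"
      by (rule sw_coassoc) (rule lin_rules)+
    also have "\<dots> = sw (*) (\<lambda>p u. \<beta> p (E u)) x"
      by (simp add: E' linear_out_sw[OF \<beta>(2)] linear_scale[OF \<beta>(2)])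
    finally show "sw (*) \<beta> (F x) = sw (*) (\<lambda>a b. \<beta> a (F b)) x"
      by (simp add: F_def linear_diff[OF L] linear_diff[OF \<beta>(2)] sw_diff vector_space_field)
  qed
  have "sw (*) (\<lambda>a b. f a * g b) (F x) = sw (*) (\<lambda>a b. f (F a) * g (F b)) x"
    if f: "lin (*) f" and g: "lin (*) g" for f g x
  proof -
    note [lin_rules] = f g lin_comp[OF f] lin_comp[OF g]
    have "sw (*) (\<lambda>a b. f a * g b) (F (F x)) = sw (*) (\<lambda>a b. f (F a) * g b) (F x)"
      by (rule sw_F(1)) (rule lin_rules)+
    also have "\<dots> = sw (*) (\<lambda>a b. f (F a) * g (F b)) x"
      by (rule sw_F(2)) (rule lin_rules)+
    finally show ?thesis by (simp add: FF)
  qed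
  note mult = this
  have "x - F x \<in> D" for x by (simp add: F_def E_mem)
  from that[of F, OF F] FD this mult show ?thesis by blast
qed

end

section \<open>Cosemisimplicity\<close>

lemma lookup_free_extend:
  "Poly_Mapping.lookup (free_extend free_scale f p) y
    = (\<Sum>x\<in>Poly_Mapping.keys p. Poly_Mapping.lookup p x * Poly_Mapping.lookup (f x) y)"
  by (simp add: free_extend_def lookup_sum)

section \<open>Separating points of the tensor square by functionals\<close>

context vector_space
begin

lemma subspace_tensor2_null: "module.subspace free_scale (tensor2_null scale)"
proof -
  interpret f: vector_space "free_scale :: 'a \<Rightarrow> ('b \<times> 'b \<Rightarrow>\<^sub>0 'a) \<Rightarrow> _"
    by (rule vector_space_free_scale)
  show ?thesis unfolding tensor2_null_def by (rule f.subspace_span)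
qed

lemma tensor2_null_generators:
  shows "free_of (a + a', b) - free_of (a, b) - free_of (a', b) \<in> tensor2_null scale"
    and "free_of (a, b + b') - free_of (a, b) - free_of (a, b') \<in> tensor2_null scale"
    and "free_of (scale r a, b) - free_scale r (free_of (a, b)) \<in> tensor2_null scale"
    and "free_of (a, scale r b) - free_scale r (free_of (a, b)) \<in> tensor2_null scale"
proof -
  interpret f: vector_space "free_scale :: 'a \<Rightarrow> ('b \<times> 'b \<Rightarrow>\<^sub>0 'a) \<Rightarrow> _"
    by (rule vector_space_free_scale)
  show "free_of (a + a', b) - free_of (a, b) - free_of (a', b) \<in> tensor2_null scale"
    "free_of (a, b + b') - free_of (a, b) - free_of (a, b') \<in> tensor2_null scale"
    "free_of (scale r a, b) - free_scale r (free_of (a, b)) \<in> tensor2_null scale"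
    "free_of (a, scale r b) - free_scale r (free_of (a, b)) \<in> tensor2_null scale"
    unfolding tensor2_null_def by (rule f.span_base, blast)+
qed

lemma tensor2_null_sum:
  assumes "finite I"
  shows "free_of ((\<Sum>i\<in>I. scale (u i) (v i)), b) - (\<Sum>i\<in>I. free_scale (u i) (free_of (v i, b)))
      \<in> tensor2_null scale" (is "?L I \<in> _")
    and "free_of (b, (\<Sum>i\<in>I. scale (u i) (v i))) - (\<Sum>i\<in>I. free_scale (u i) (free_of (b, v i)))
      \<in> tensor2_null scale" (is "?R I \<in> _")
proof -
  interpret f: vector_space "free_scale :: 'a \<Rightarrow> ('b \<times> 'b \<Rightarrow>\<^sub>0 'a) \<Rightarrow> _"
    by (rule vector_space_free_scale)
  note add = f.subspace_add[OF subspace_tensor2_null]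
  show "?L I \<in> tensor2_null scale"
    using assms
  proof (induction I)
    case empty
    \<comment> \<open>The scaling relation with scalar \<open>0\<close> shows that
      \<open>free_of (0, b)\<close> is null.\<close>
    show ?case using tensor2_null_generators(3)[of 0 0 b] by simp
  next
    case (insert i I)
    let ?s = "\<Sum>i\<in>I. scale (u i) (v i)"
    have "?L (insert i I) = (free_of (scale (u i) (v i) + ?s, b) - free_of (scale (u i) (v i), b)
        - free_of (?s, b)) + (free_of (scale (u i) (v i), b) - free_scale (u i) (free_of (v i, b))) + ?L I"
      using insert by simp
    then show ?case
      by (simp only: add tensor2_null_generators insert.IH)
  qed
  show "?R I \<in> tensor2_null scale"
    using assms
  proof (induction I)
    case empty
    show ?case using tensor2_null_generators(4)[of b 0 0] by simp
  next
    case (insert i I)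
    let ?s = "\<Sum>i\<in>I. scale (u i) (v i)"
    have "?R (insert i I) = (free_of (b, scale (u i) (v i) + ?s) - free_of (b, scale (u i) (v i))
        - free_of (b, ?s)) + (free_of (b, scale (u i) (v i)) - free_scale (u i) (free_of (b, v i))) + ?R I"
      using insert by simp
    then show ?case
      by (simp only: add tensor2_null_generators insert.IH)
  qed
qed

end

context fd_hopf_algebra
begin

text \<open>Modulo the null space every formal sum reduces to basis tensors \<open>(i, l)\<close>,
  with coefficients obtained by applying the functionals \<open>cd i\<close> and \<open>cd l\<close>
  to the two legs.\<close>

lemma tensor2_class_eqI:
  assumes eq: "\<And>f g. lin (*) f \<Longrightarrow> lin (*) g \<Longrightarrow>
    free_extend (*) (\<lambda>(a, b). f a * g b) p = free_extend (*) (\<lambda>(a, b). f a * g b) q"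
  shows "tensor2_class scale p = tensor2_class scale q"
proof -
  interpret f: vector_space "free_scale :: 'k \<Rightarrow> ('h \<times> 'h \<Rightarrow>\<^sub>0 'k) \<Rightarrow> _"
    by (rule vector_space_free_scale)
  note sub = subspace_tensor2_null
  \<comment> \<open>\<open>N\<close> is the normal form of a pure tensor, obtained by expanding both
    legs in the basis.\<close>
  define N :: "'h \<times> 'h \<Rightarrow> ('h \<times> 'h \<Rightarrow>\<^sub>0 'k)" where
    "N = (\<lambda>(a, b). \<Sum>i\<in>Basis. \<Sum>l\<in>Basis. free_scale (cd i a * cd l b) (free_of (i, l)))"
  have N: "free_of x - N x \<in> tensor2_null scale" for x
  proof (cases x)
    case (Pair a b)
    have "free_of x - N x
      = (free_of (\<Sum>i\<in>Basis. scale (cd i a) i, b) - (\<Sum>i\<in>Basis. free_scale (cd i a) (free_of (i, b))))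
       + (\<Sum>i\<in>Basis. free_scale (cd i a)
          (free_of (i, \<Sum>l\<in>Basis. scale (cd l b) l) - (\<Sum>l\<in>Basis. free_scale (cd l b) (free_of (i, l)))))"
      by (simp add: Pair N_def sum_cd f.scale_right_diff_distrib f.scale_sum_right sum_subtractf)
    then show ?thesis
      by (simp only:) (intro f.subspace_add[OF sub] f.subspace_sum[OF sub] f.subspace_scale[OF sub]
        tensor2_null_sum finite_Basis)
  qed
  have NN: "p - free_extend free_scale N p \<in> tensor2_null scale" for p
  proof -
    have "p - free_extend free_scale N p
      = (\<Sum>x\<in>Poly_Mapping.keys p. free_scale (Poly_Mapping.lookup p x) (free_of x - N x))"
      using free_extend_free_of[of p]
      by (simp add: free_extend_def f.scale_right_diff_distrib sum_subtractf)
    then show ?thesis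
      by (simp only:) (intro f.subspace_sum[OF sub] f.subspace_scale[OF sub] N)
  qed
  have "free_extend free_scale N p
    = (\<Sum>i\<in>Basis. \<Sum>l\<in>Basis. free_scale (free_extend (*) (\<lambda>(a, b). cd i a * cd l b) p) (free_of (i, l)))" for p
    unfolding free_extend_def N_def case_prod_unfold f.scale_sum_right f.scale_sum_left
    by (subst sum.swap, rule sum.cong[OF refl], subst sum.swap) simp
  then have "free_extend free_scale N p = free_extend free_scale N q"
    by (simp add: eq[OF lin_cd lin_cd])
  with f.subspace_diff[OF sub NN[of p] NN[of q]] show ?thesis
    by (simp add: tensor2_class_eq_iff)
qed

end

section \<open>Splitting off subcoalgebras and induction on the dimension\<close>

context integral_hopf_algebra
begin

text \<open>The complement consists of the fixed points in \<open>D\<close> of the projection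
  \<open>F\<close> that kills \<open>E\<close>; the decomposition is
  \<open>x = (x - F x) + F x\<close>.\<close>

lemma complement:
  assumes D: "subcoalgebra scale \<Delta> D" and E: "subcoalgebra scale \<Delta> E" "E \<subseteq> D"
  obtains E' where "subcoalgebra scale \<Delta> E'" "E' \<subseteq> D" "E \<inter> E' = {0}"
    "\<And>x. x \<in> D \<Longrightarrow> \<exists>y\<in>E. \<exists>z\<in>E'. x = y + z"
proof -
  have subD: "subspace D" and subE: "subspace E"
    using D E by (simp_all add: subcoalgebra_def)
  obtain F where F: "lin scale F" "\<And>x. x \<in> E \<Longrightarrow> F x = 0" "\<And>x. x - F x \<in> E"
    and F_mult: "\<And>f g x. lin (*) f \<Longrightarrow> lin (*) g \<Longrightarrow>
      sw (*) (\<lambda>a b. f a * g b) (F x) = sw (*) (\<lambda>a b. f (F a) * g (F b)) x"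
    using ex_complementary_projection[OF E(1)] by blast
  have FF: "F (F x) = F x" for x
    using F(2)[OF F(3)[of x]] by (simp add: linear_diff[OF F(1)])
  have FD: "F x \<in> D" if "x \<in> D" for x
    using subspace_diff[OF subD that, of "x - F x"] F(3)[of x] E(2) by auto
  define E' where "E' = {x \<in> D. F x = x}"
  have "subspace E'"
    using subD by (auto simp: subspace_def E'_def linear_zero[OF F(1)] linear_add[OF F(1)]
        linear_scale[OF F(1)])
  moreover have "\<Delta> x \<in> tensor2_class scale ` {p. Poly_Mapping.keys p \<subseteq> E' \<times> E'}" if x: "x \<in> E'" for x
  proof -
    have xD: "x \<in> D" and Fx: "F x = x" using x by (auto simp: E'_def)
    obtain p where p: "\<Delta> x = tensor2_class scale p" "Poly_Mapping.keys p \<subseteq> D \<times> D"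
      by (rule subcoalgebra_rep[OF D xD])
    \<comment> \<open>Applying \<open>F\<close> to both legs moves the support into
      \<open>E' \<times> E'\<close>. The class is unchanged because \<open>F x = x\<close> and
      \<open>F\<close> respects the comultiplication.\<close>
    define q where "q = free_extend free_scale (\<lambda>(a, b). free_of (F a, F b)) p"
    have "Poly_Mapping.keys q \<subseteq> E' \<times> E'"
    proof
      fix y
      assume "y \<in> Poly_Mapping.keys q"
      then have "Poly_Mapping.lookup q y \<noteq> 0" by (simp add: in_keys_iff)
      then obtain z where "z \<in> Poly_Mapping.keys p"
        "Poly_Mapping.lookup (free_of (F (fst z), F (snd z)) :: _ \<Rightarrow>\<^sub>0 'k) y \<noteq> 0"
        unfolding q_def lookup_free_extend case_prod_unfold
        by (metis (no_types, lifting) mult_zero_right sum.neutral)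
      then show "y \<in> E' \<times> E'"
        using p(2) by (auto simp: free_of_def lookup_single when_def E'_def FF FD split: if_splits)
    qed
    moreover have "tensor2_class scale p = tensor2_class scale q"
    proof (rule tensor2_class_eqI)
      fix f g :: "'h \<Rightarrow> 'k"
      assume f: "lin (*) f" and g: "lin (*) g"
      note [lin_rules] = f g lin_comp[OF f lin_comp[OF F(1)]] lin_comp[OF g lin_comp[OF F(1)]]
      have "free_extend (*) (\<lambda>(a, b). f a * g b) p = sw (*) (\<lambda>a b. f a * g b) x"
        by (rule sw_class[OF _ _ p(1), symmetric]) (rule lin_rules)+
      also have "\<dots> = sw (*) (\<lambda>a b. f (F a) * g (F b)) x"
        using F_mult[OF f g, of x] by (simp add: Fx)
      also have "\<dots> = free_extend (*) (\<lambda>(a, b). f (F a) * g (F b)) p"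
        by (rule sw_class[OF _ _ p(1)]) (rule lin_rules)+
      also have "\<dots> = free_extend (*) (\<lambda>(a, b). f a * g b) q"
        unfolding q_def free_extend_free_extend[OF vector_space_field]
        by (simp add: case_prod_unfold vector_space_field)
      finally show "free_extend (*) (\<lambda>(a, b). f a * g b) p = free_extend (*) (\<lambda>(a, b). f a * g b) q" .
    qed
    ultimately show ?thesis using p(1) by blast
  qed
  ultimately have "subcoalgebra scale \<Delta> E'" by (simp add: subcoalgebra_def)
  moreover have "E' \<subseteq> D" by (auto simp: E'_def)
  moreover have "E \<inter> E' = {0}"
    using F(2) subspace_0[OF subE] subspace_0[OF subD] linear_zero[OF F(1)] by (auto simp: E'_def)
  moreover have "\<exists>y\<in>E. \<exists>z\<in>E'. x = y + z" if "x \<in> D" for x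
    by (rule bexI[OF _ F(3)[of x]], rule bexI[of _ "F x"]) (auto simp: E'_def FF FD that)
  ultimately show ?thesis by (rule that)
qed

lemma subcoalgebra_subset_coradical:
  assumes "subcoalgebra scale \<Delta> D"
  shows "D \<subseteq> coradical scale \<Delta>"
  using assms
proof (induction "dim D" arbitrary: D rule: less_induct)
  case less
  have sub: "subspace D" using less.prems by (simp add: subcoalgebra_def)
  have less_dim: "dim E < dim D" if "subcoalgebra scale \<Delta> E" "E \<subset> D" for E
    using that sub by (intro dim_psubset) (auto simp: subcoalgebra_def span_eq_iff[THEN iffD2])
  consider "D = {0}" | "simple_subcoalgebra scale \<Delta> D"
    | E where "subcoalgebra scale \<Delta> E" "E \<subset> D" "E \<noteq> {0}"
    using less.prems unfolding simple_subcoalgebra_def by blast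
  then show ?case
  proof cases
    case 1
    then show ?thesis by (simp add: coradical_def span_zero)
  next
    case 2
    then show ?thesis by (auto simp: coradical_def intro: span_base)
  next
    case (3 E)
    obtain E' where E': "subcoalgebra scale \<Delta> E'" "E' \<subseteq> D" "E \<inter> E' = {0}"
      "\<And>x. x \<in> D \<Longrightarrow> \<exists>y\<in>E. \<exists>z\<in>E'. x = y + z"
      using complement[OF less.prems 3(1)] 3(2) by blast
    \<comment> \<open>Equality would give \<open>E = E \<inter> E' = {0}\<close>; so both summands
      are proper and the induction hypothesis covers them.\<close>
    have "E' \<noteq> D" using 3(2,3) E'(3) by blast
    then have "E \<subseteq> coradical scale \<Delta>" "E' \<subseteq> coradical scale \<Delta>"
      using less.hyps less_dim 3 E'(1,2) by auto
    then have "y + z \<in> coradical scale \<Delta>" if "y \<in> E" "z \<in> E'" for y z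
      using that unfolding coradical_def by (auto intro: span_add)
    then show ?thesis
      using E'(4) by blast
  qed
qed

lemma cosemisimple: "cosemisimple scale \<Delta>"
proof -
  have "subcoalgebra scale \<Delta> UNIV"
    using comult_closed by (auto simp: subcoalgebra_def tensor2_space_def)
  from subcoalgebra_subset_coradical[OF this] show ?thesis
    by (auto simp: cosemisimple_def)
qed

end

theorem mainTheorem5:
  fixes scale :: "'k::field \<Rightarrow> 'h::ring_1 \<Rightarrow> 'h"
    and \<Delta> :: "'h \<Rightarrow> ('h \<times> 'h \<Rightarrow>\<^sub>0 'k) set"
    and \<epsilon> :: "'h \<Rightarrow> 'k"
    and S :: "'h \<Rightarrow> 'h"
  assumes "hopf_algebra scale \<Delta> \<epsilon> S"
    and "\<exists>Basis. finite_dimensional_vector_space scale Basis"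
    and "nonsingular_coalgebra scale \<Delta> \<epsilon>"
  shows "cosemisimple scale \<Delta>"
proof -
  obtain Basis where "finite_dimensional_vector_space scale Basis"
    using assms(2) ..
  with assms(1) interpret fd_hopf_algebra scale \<Delta> \<epsilon> S Basis
    by (simp add: fd_hopf_algebra_def)
  obtain j where j: "lin (*) j" "j 1 = 1"
    "\<And>f x. lin (*) f \<Longrightarrow> sw (*) (\<lambda>a b. f a * j b) x = f 1 * j x"
    by (rule nonsingular_normalized_integral[OF assms(3)]) (rule that)
  interpret integral_hopf_algebra scale \<Delta> \<epsilon> S Basis j
    by (intro integral_hopf_algebra.intro fd_hopf_algebra_axioms integral_hopf_algebra_axioms.intro j)
  show ?thesis by (rule cosemisimple)
qed

end
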